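(* Assume $\Omega$ is a finite probability space and the translation operators $\tau_x:\Omega\to\Omega$, $x\in\mathbf{Z}^d$, are ergodic. Let $b:\Omega\to\mathbf{R}$ satisfy $\sup_{\omega\in\Omega}|b(\omega)|<\frac{1}{2d}$ and the reflection invariance condition $$\Big\langle \prod_{i=1}^n b(\tau_{x_i}\,\cdot)\Big\rangle=(-1)^n\Big\langle \prod_{i=1}^n b(\tau_{Rx_i}\,\cdot)\Big\rangle,\qquad x_i\in\mathbf{Z}^d,\ 1\le i\le n,\ n\ge 1 .$$ Then there exists $q(b)$ with $0<q(b)<\infty$ such that the following holds for every smooth compactly supported $f:\mathbf{R}^d\to\mathbf{R}$. For $\varepsilon>0$ let $u_\varepsilon(x,\omega)$, $x\in\varepsilon\mathbf{Z}^d$, $\omega\in\Omega$, be the unique bounded solution of $$u_\varepsilon(x,\omega)-\sum_{i=1}^d\frac{1}{2d}\big[u_\varepsilon(x+\varepsilon\mathbf{e}_i,\omega)+u_\varepsilon(x-\varepsilon\mathbf{e}_i,\omega)\big]-b(\tau_{x/\varepsilon}\,\omega)\big[u_\varepsilon(x+\varepsilon\mathbf{e}_1,\omega)-u_\varepsilon(x-\varepsilon\mathbf{e}_1,\omega)\big]+\varepsilon^2u_\varepsilon(x,\omega)=\varepsilon^2f(x),$$ and let $u$ be the bounded solution of $$-q(b)\frac{\partial^2u}{\partial x_1^2}-\sum_{j=2}^d\frac{1}{2d}\frac{\partial^2u}{\partial x_j^2}+u(x)=f(x),\qquad x\in\mathbf{R}^d .$$ Then $$\lim_{\varepsilon\to0}\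 \sup_{x\in\mathbf{R}^d,\ \omega\in\Omega}\big|u_\varepsilon(\varepsilon\lfloor x/\varepsilon\rfloor,\omega)-u(x)\big|=0 .$$
   Context: $d\ge1$ is an integer, $\mathbf{e}_1,\dots,\mathbf{e}_d$ is the standard basis of $\mathbf{Z}^d$, $R(x_1,x_2,\dots,x_d)=(-x_1,x_2,\dots,x_d)$, $\langle\cdot\rangle$ denotes expectation on $\Omega$, and $\lfloor\cdot\rfloor$ denotes the (componentwise) integer part. The operators $\tau_x:\Omega\to\Omega$, $x\in\mathbf{Z}^d$, are measure preserving and satisfy $\tau_x\tau_y=\tau_{x+y}$, $\tau_0=$ identity. Ergodic means that the only subsets of $\Omega$ invariant under all $\tau_x$ are $\emptyset$ and $\Omega$. *)

theory Defs
  imports "HOL-Probability.Probability"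
begin

text \<open>
  Throughout, \<open>\<real>\<^sup>d\<close> is \<open>real ^ 'd\<close> and \<open>\<int>\<^sup>d\<close> is \<open>int ^ 'd\<close> for an arbitrary nonempty finite index type
  \<open>'d\<close>, with \<open>d = CARD('d)\<close>.  The coordinates are not ordered; an arbitrary distinguished index
  \<open>k :: 'd\<close> plays the role of the first coordinate direction.
\<close>

definition reflect :: "'d \<Rightarrow> int ^ 'd \<Rightarrow> int ^ 'd" where
  "reflect k x = (\<chi> i. if i = k then - (x $ i) else x $ i)"

definition floor_vec :: "real ^ 'd \<Rightarrow> int ^ 'd" where
  "floor_vec x = (\<chi> i. \<lfloor>x $ i\<rfloor>)"

text \<open>The point \<open>\<epsilon> z\<close> of the scaled lattice \<open>\<epsilon>\<int>\<^sup>d\<close>, for \<open>z \<in> \<int>\<^sup>d\<close>.\<close>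

definition lattice_point :: "real \<Rightarrow> int ^ 'd \<Rightarrow> real ^ 'd" where
  "lattice_point \<epsilon> z = \<epsilon> *\<^sub>R (\<chi> i. real_of_int (z $ i))"

definition measure_preserving_action :: "'a measure \<Rightarrow> (int ^ 'd \<Rightarrow> 'a \<Rightarrow> 'a) \<Rightarrow> bool" where
  "measure_preserving_action M \<tau> \<longleftrightarrow>
     (\<forall>x. \<tau> x \<in> M \<rightarrow>\<^sub>M M \<and> distr M M (\<tau> x) = M) \<and>
     (\<forall>x y. \<forall>\<omega>\<in>space M. \<tau> x (\<tau> y \<omega>) = \<tau> (x + y) \<omega>) \<and>
     (\<forall>\<omega>\<in>space M. \<tau> 0 \<omega> = \<omega>)"

text \<open>
  On a finite probability space ergodicity is meant in the strict sense (no null sets are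
  disregarded).
\<close>

definition ergodic_action :: "'a measure \<Rightarrow> (int ^ 'd \<Rightarrow> 'a \<Rightarrow> 'a) \<Rightarrow> bool" where
  "ergodic_action M \<tau> \<longleftrightarrow>
     (\<forall>A\<subseteq>space M. (\<forall>x. \<tau> x ` A = A) \<longrightarrow> A = {} \<or> A = space M)"

definition reflection_invariant ::
    "'a measure \<Rightarrow> (int ^ 'd \<Rightarrow> 'a \<Rightarrow> 'a) \<Rightarrow> 'd \<Rightarrow> ('a \<Rightarrow> real) \<Rightarrow> bool" where
  "reflection_invariant M \<tau> k b \<longleftrightarrow>
     (\<forall>n\<ge>1. \<forall>x :: nat \<Rightarrow> int ^ 'd.
        (\<integral>\<omega>. (\<Prod>i=1..n. b (\<tau> (x i) \<omega>)) \<partial>M) =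
        (- 1) ^ n * (\<integral>\<omega>. (\<Prod>i=1..n. b (\<tau> (reflect k (x i)) \<omega>)) \<partial>M))"

definition partial_deriv :: "'d \<Rightarrow> (real ^ 'd \<Rightarrow> real) \<Rightarrow> real ^ 'd \<Rightarrow> real" where
  "partial_deriv i f x = frechet_derivative f (at x) (axis i 1)"

text \<open>\<open>f\<close> is of class \<open>C\<^sup>n\<close> on the whole of \<open>\<real>\<^sup>d\<close>.\<close>

primrec Ck :: "nat \<Rightarrow> (real ^ 'd \<Rightarrow> real) \<Rightarrow> bool" where
  "Ck 0 f \<longleftrightarrow> continuous_on UNIV f"
| "Ck (Suc n) f \<longleftrightarrow> (\<forall>x. f differentiable (at x)) \<and> (\<forall>i. Ck n (partial_deriv i f))"

definition smooth :: "(real ^ 'd \<Rightarrow> real) \<Rightarrow> bool" where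
  "smooth f \<longleftrightarrow> (\<forall>n. Ck n f)"

definition compactly_supported :: "(real ^ 'd \<Rightarrow> real) \<Rightarrow> bool" where
  "compactly_supported f \<longleftrightarrow> compact (closure {x. f x \<noteq> 0})"

text \<open>
  Only the values of \<open>v\<close> on \<open>\<epsilon>\<int>\<^sup>d \<times> \<Omega>\<close> are constrained.  At \<open>x = \<epsilon> z\<close> the shift \<open>\<tau>\<close> with index
  \<open>x / \<epsilon>\<close> is \<open>\<tau> z\<close>.
\<close>

definition lattice_solution ::
    "'a measure \<Rightarrow> (int ^ 'd \<Rightarrow> 'a \<Rightarrow> 'a) \<Rightarrow> 'd \<Rightarrow> ('a \<Rightarrow> real) \<Rightarrow> (real ^ 'd \<Rightarrow> real) \<Rightarrow> real \<Rightarrow>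
      (real ^ 'd \<Rightarrow> 'a \<Rightarrow> real) \<Rightarrow> bool" where
  "lattice_solution M \<tau> k b f \<epsilon> v \<longleftrightarrow>
     (\<forall>z. \<forall>\<omega>\<in>space M. let x = lattice_point \<epsilon> z in
        v x \<omega>
        - (\<Sum>i\<in>UNIV. 1 / (2 * real CARD('d)) *
             (v (x + \<epsilon> *\<^sub>R axis i 1) \<omega> + v (x - \<epsilon> *\<^sub>R axis i 1) \<omega>))
        - b (\<tau> z \<omega>) * (v (x + \<epsilon> *\<^sub>R axis k 1) \<omega> - v (x - \<epsilon> *\<^sub>R axis k 1) \<omega>)
        + \<epsilon>\<^sup>2 * v x \<omega> = \<epsilon>\<^sup>2 * f x)"

definition bounded_lattice_solution ::
    "'a measure \<Rightarrow> (int ^ 'd \<Rightarrow> 'a \<Rightarrow> 'a) \<Rightarrow> 'd \<Rightarrow> ('a \<Rightarrow> real) \<Rightarrow> (real ^ 'd \<Rightarrow> real) \<Rightarrow> real \<Rightarrow>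
      (real ^ 'd \<Rightarrow> 'a \<Rightarrow> real) \<Rightarrow> bool" where
  "bounded_lattice_solution M \<tau> k b f \<epsilon> v \<longleftrightarrow>
     lattice_solution M \<tau> k b f \<epsilon> v \<and>
     bounded {v x \<omega> | x \<omega>. x \<in> range (lattice_point \<epsilon>) \<and> \<omega> \<in> space M}"

text \<open>Solutions of the homogenized equation are classical, i.e. of class \<open>C\<^sup>2\<close>.\<close>

definition bounded_homogenized_solution ::
    "'d \<Rightarrow> real \<Rightarrow> (real ^ 'd \<Rightarrow> real) \<Rightarrow> (real ^ 'd \<Rightarrow> real) \<Rightarrow> bool" where
  "bounded_homogenized_solution k q f u \<longleftrightarrow>
     Ck 2 u \<and> bounded (range u) \<and>
     (\<forall>x. - q * partial_deriv k (partial_deriv k u) x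
          - (\<Sum>j\<in>UNIV - {k}. 1 / (2 * real CARD('d)) * partial_deriv j (partial_deriv j u) x)
          + u x = f x)"

end

theory Submission
  imports Defs
begin

text \<open>
  The environment seen from the walk is a Markov chain on the finite set \<open>\<Omega>\<close> with generator \<open>L\<close>
  (\<open>env_gen\<close> below). By the strong maximum principle and finite-dimensional linear algebra,
  \<open>L h = g - c\<close> is solvable for exactly one constant \<open>c\<close> for every \<open>g\<close>. Reflection invariance
  yields two points \<open>\<omega>\<^sub>0, \<omega>\<^sub>1\<close> of \<open>\<Omega>\<close> whose drift fields are exchanged, up to sign, by \<open>R\<close>, and
  for functions that are antisymmetric under this exchange the constant is \<open>0\<close>. This gives a first
  corrector \<open>\<phi>\<close> with \<open>L \<phi> = - 2 b\<close>, again antisymmetric up to an additive constant, so that the mixed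
  second-order coefficients vanish; the coefficient \<open>q\<close> of the second derivative in the
  distinguished direction is half the mean squared increment of the harmonic coordinate
  \<open>x\<^sub>1 + \<phi>\<close>, hence positive.

  The solution \<open>u\<close> of the homogenized equation is a uniform limit of approximate solutions of a
  translation invariant difference scheme; these commute with derivatives, so \<open>u\<close> inherits bounded
  derivatives of all orders from \<open>f\<close>. Inserting
  \<open>u + \<epsilon> \<phi> \<partial>\<^sub>1 u + \<epsilon>\<^sup>2 \<Sum>\<^sub>j \<psi>\<^sub>j \<partial>\<^sub>j \<partial>\<^sub>1 u\<close> into the lattice equation leaves a residual
  \<open>O(\<epsilon>\<^sup>3)\<close>, and the maximum principle for the lattice equation costs a factor \<open>\<epsilon>\<^sup>-\<^sup>2\<close>.
\<close>

section \<open>Sup-norm contractions and finite linear systems\<close>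

text \<open>Common frame for two averaging operators: \<open>walk_mean\<close> on the lattice and
  \<open>shift_mean\<close> on \<real>^d. Compatibility with differences and nonexpansiveness in the
  sup norm suffice for existence and uniqueness of bounded solutions of (1 + \<kappa>) v = P v +
  \<kappa> g.\<close>

locale sup_contraction =
  fixes P :: "('x \<Rightarrow> real) \<Rightarrow> 'x \<Rightarrow> real"
  assumes diff: "P (\<lambda>y. u y - v y) x = P u x - P v x"
    and bound: "(\<And>y. \<bar>v y\<bar> \<le> K) \<Longrightarrow> \<bar>P v x\<bar> \<le> K"
begin

text \<open>With S = sup |V|, nonexpansiveness gives (1 + \<kappa>) |V x| \<le> K + S at every x,
  hence (1 + \<kappa>) S \<le> K + S. Boundedness makes S finite; it need not be attained.\<close>

lemma max_principle:
  assumes "\<kappa> > 0" and bdd: "bounded (range V)"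
    and res: "\<And>x. \<bar>(1 + \<kappa>) * V x - P V x\<bar> \<le> K"
  shows "\<bar>V x\<bar> \<le> K / \<kappa>"
proof -
  define S where "S = (SUP y. \<bar>V y\<bar>)"
  obtain B where "\<And>y. \<bar>V y\<bar> \<le> B"
    using bdd by (auto simp: bounded_iff)
  then have "bdd_above (range (\<lambda>y. \<bar>V y\<bar>))"
    by (intro bdd_aboveI2)
  then have le_S: "\<bar>V y\<bar> \<le> S" for y
    unfolding S_def by (rule cSUP_upper[OF UNIV_I])
  have "\<bar>V y\<bar> \<le> (K + S) / (1 + \<kappa>)" for y
  proof -
    have "(1 + \<kappa>) * \<bar>V y\<bar> = \<bar>(1 + \<kappa>) * V y\<bar>"
      using \<open>\<kappa> > 0\<close> by (simp add: abs_mult)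
    also have "\<dots> \<le> K + S"
      using res[of y] bound[of V S y] le_S by fastforce
    finally show ?thesis
      using \<open>\<kappa> > 0\<close> by (simp add: field_simps)
  qed
  then have "S \<le> (K + S) / (1 + \<kappa>)"
    unfolding S_def by (intro cSUP_least) auto
  then have "S \<le> K / \<kappa>"
    using \<open>\<kappa> > 0\<close> by (simp add: field_simps)
  then show ?thesis
    using le_S[of x] by linarith
qed

text \<open>Fixed-point iteration for (1 + \<kappa>) v = P v + \<kappa> g, started at 0. The factor
  \<kappa> in front of g makes every sup bound of g a bound of all iterates.\<close>

primrec resolvent_iterate :: "real \<Rightarrow> ('x \<Rightarrow> real) \<Rightarrow> nat \<Rightarrow> 'x \<Rightarrow> real" where
  "resolvent_iterate \<kappa> g 0 = (\<lambda>x. 0)"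
| "resolvent_iterate \<kappa> g (Suc m) = (\<lambda>x. (P (resolvent_iterate \<kappa> g m) x + \<kappa> * g x) / (1 + \<kappa>))"

lemma resolvent_iterate_bound:
  assumes "\<kappa> > 0" and g: "\<And>x. \<bar>g x\<bar> \<le> K"
  shows "\<bar>resolvent_iterate \<kappa> g m x\<bar> \<le> K"
proof (induction m arbitrary: x)
  case 0
  show ?case using g[of x] by simp
next
  case (Suc m)
  have "\<bar>P (resolvent_iterate \<kappa> g m) x + \<kappa> * g x\<bar> \<le> \<bar>P (resolvent_iterate \<kappa> g m) x\<bar> + \<kappa> * \<bar>g x\<bar>"
    using \<open>\<kappa> > 0\<close> abs_triangle_ineq[of "P (resolvent_iterate \<kappa> g m) x" "\<kappa> * g x"]
    by (simp add: abs_mult)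
  also have "\<dots> \<le> K + \<kappa> * K"
    using bound[OF Suc] g[of x] \<open>\<kappa> > 0\<close> by (intro add_mono mult_left_mono) auto
  finally show ?case
    using \<open>\<kappa> > 0\<close> by (simp add: abs_divide field_simps)
qed

text \<open>Successive increments obey the recursion without source term, so each step gains a
  factor 1 / (1 + \<kappa>).\<close>

lemma resolvent_iterate_increment:
  assumes "\<kappa> > 0" and g: "\<And>x. \<bar>g x\<bar> \<le> K"
  shows "\<bar>resolvent_iterate \<kappa> g (Suc m) x - resolvent_iterate \<kappa> g m x\<bar> \<le> K * (1 / (1 + \<kappa>)) ^ m"
proof (induction m arbitrary: x)
  case 0
  show ?case using resolvent_iterate_bound[of \<kappa> g K "Suc 0" x] assms by simp
next
  case (Suc m)
  have "resolvent_iterate \<kappa> g (Suc (Suc m)) x - resolvent_iterate \<kappa> g (Suc m) x =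
      P (\<lambda>y. resolvent_iterate \<kappa> g (Suc m) y - resolvent_iterate \<kappa> g m y) x / (1 + \<kappa>)"
    unfolding diff by (simp flip: diff_divide_distrib)
  moreover have "\<bar>P (\<lambda>y. resolvent_iterate \<kappa> g (Suc m) y - resolvent_iterate \<kappa> g m y) x\<bar>
      \<le> K * (1 / (1 + \<kappa>)) ^ m"
    by (rule bound) (rule Suc)
  ultimately have "\<bar>resolvent_iterate \<kappa> g (Suc (Suc m)) x - resolvent_iterate \<kappa> g (Suc m) x\<bar>
      \<le> K * (1 / (1 + \<kappa>)) ^ m / (1 + \<kappa>)"
    using \<open>\<kappa> > 0\<close> by (simp only: abs_divide) (auto intro: divide_right_mono)
  then show ?case
    by (simp add: power_divide mult.commute)
qed

lemma bounded_solution_exists: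
  assumes "\<kappa> > 0" and "bounded (range g)"
  obtains v where "bounded (range v)" "\<And>x. (1 + \<kappa>) * v x = P v x + \<kappa> * g x"
proof -
  obtain K where K: "\<And>x. \<bar>g x\<bar> \<le> K"
    using assms(2) by (auto simp: bounded_iff)
  let ?w = "resolvent_iterate \<kappa> g"
  \<comment> \<open>The limit is written as a telescoping series, so that a geometric majorant
    yields uniform convergence by the Weierstrass test.\<close>
  define v where "v x = (\<Sum>m. ?w (Suc m) x - ?w m x)" for x
  have "summable (\<lambda>m. K * (1 / (1 + \<kappa>)) ^ m)"
    using \<open>\<kappa> > 0\<close> by (intro summable_mult summable_geometric) auto
  then have "uniform_limit UNIV (\<lambda>n x. \<Sum>m<n. ?w (Suc m) x - ?w m x) v sequentially"
    unfolding v_def using resolvent_iterate_increment[of \<kappa> g K, OF \<open>\<kappa> > 0\<close> K]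
    by (intro Weierstrass_m_test[where M = "\<lambda>m. K * (1 / (1 + \<kappa>)) ^ m"])
      (simp_all del: resolvent_iterate.simps)
  moreover have "(\<Sum>m<n. ?w (Suc m) x - ?w m x) = ?w n x" for n x
    using sum_lessThan_telescope[of "\<lambda>m. ?w m x" n] by simp
  ultimately have lim: "uniform_limit UNIV ?w v sequentially"
    by (simp del: resolvent_iterate.simps)
  have limw: "(\<lambda>m. ?w m x) \<longlonglongrightarrow> v x" for x
    using tendsto_uniform_limitI[OF lim] by simp
  \<comment> \<open>For an abstract P, pointwise convergence would not pass through P; uniform
    convergence does, by nonexpansiveness applied to the difference.\<close>
  have limP: "(\<lambda>m. P (?w m) x) \<longlonglongrightarrow> P v x" for x
  proof (rule tendstoI)
    fix e :: real assume "e > 0"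
    then have "\<forall>\<^sub>F m in sequentially. \<forall>y\<in>UNIV. dist (?w m y) (v y) < e / 2"
      by (intro uniform_limitD[OF lim]) simp
    then show "\<forall>\<^sub>F m in sequentially. dist (P (?w m) x) (P v x) < e"
    proof eventually_elim
      case (elim m)
      have "\<bar>P (\<lambda>y. ?w m y - v y) x\<bar> \<le> e / 2"
        by (rule bound) (use elim in \<open>auto simp: dist_real_def less_imp_le\<close>)
      then show ?case
        using \<open>e > 0\<close> unfolding diff by (simp add: dist_real_def)
    qed
  qed
  have "\<bar>v x\<bar> \<le> K" for x
    by (rule LIMSEQ_le_const2[OF tendsto_rabs[OF limw]])
      (use resolvent_iterate_bound[OF \<open>\<kappa> > 0\<close> K] in auto)
  then have "bounded (range v)"
    by (auto simp: bounded_iff)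
  moreover have "(1 + \<kappa>) * v x = P v x + \<kappa> * g x" for x
  proof -
    have "(\<lambda>m. ?w (Suc m) x) \<longlonglongrightarrow> (P v x + \<kappa> * g x) / (1 + \<kappa>)"
      unfolding resolvent_iterate.simps
      by (intro tendsto_intros limP) (use \<open>\<kappa> > 0\<close> in auto)
    then have "v x = (P v x + \<kappa> * g x) / (1 + \<kappa>)"
      using LIMSEQ_unique LIMSEQ_Suc[OF limw] by blast
    then show ?thesis
      using \<open>\<kappa> > 0\<close> by (simp add: field_simps)
  qed
  ultimately show ?thesis
    by (rule that)
qed

end

text \<open>Gaussian elimination, one column at a time. The trivial kernel provides a pivot row for
  column \<open>a\<close>, and both the trivial kernel and \<open>card R \<le> card C\<close>
  survive deletion of the pivot row and column.\<close>

lemma linear_system_solvable: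
  fixes A :: "'r \<Rightarrow> 'c \<Rightarrow> real"
  assumes "finite C" and "finite R" and "card R \<le> card C"
    and "\<And>v. (\<And>x. x \<in> R \<Longrightarrow> (\<Sum>y\<in>C. A x y * v y) = 0) \<Longrightarrow> \<forall>y\<in>C. v y = 0"
  shows "\<exists>v. \<forall>x\<in>R. (\<Sum>y\<in>C. A x y * v y) = g x"
  using assms
proof (induction C arbitrary: R A g rule: finite_induct)
  case empty
  then show ?case by simp
next
  case (insert a C)
  show ?case
  proof (cases "R = {}")
    case False
    obtain x0 where x0: "x0 \<in> R" "A x0 a \<noteq> 0"
    proof (rule ccontr)
      assume "\<not> thesis"
      then have "\<And>x. x \<in> R \<Longrightarrow> A x a = 0"
        using that by blast
      \<comment> \<open>Without a pivot the unit vector at \<open>a\<close> would lie in the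
        kernel.\<close>
      then have "\<forall>y\<in>insert a C. (if y = a then 1 else 0 :: real) = 0"
        using insert.hyps by (intro insert.prems(3)) (auto intro: sum.neutral)
      then show False by simp
    qed
    \<comment> \<open>\<open>A'\<close> is the Schur complement after eliminating column
      \<open>a\<close> with row \<open>x0\<close>; \<open>ext h v\<close> back-substitutes the entry
      at \<open>a\<close> so that row \<open>x0\<close> takes the value \<open>h x0\<close>. The
      kernel is treated with h = 0, the solution with h = g.\<close>
    define A' where "A' x y = A x y - A x a / A x0 a * A x0 y" for x y
    define ext where
      "ext h v = v(a := (h x0 - (\<Sum>y\<in>C. A x0 y * v y)) / A x0 a)" for h :: "'r \<Rightarrow> real" and v
    have ext: "(\<Sum>y\<in>insert a C. A x y * ext h v y) - h x
        = (\<Sum>y\<in>C. A' x y * v y) - (h x - A x a / A x0 a * h x0)" for x h v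
    proof -
      have "(\<Sum>y\<in>C. A x y * ext h v y) = (\<Sum>y\<in>C. A x y * v y)"
        using insert.hyps by (intro sum.cong) (auto simp: ext_def)
      moreover have "(\<Sum>y\<in>C. A' x y * v y)
          = (\<Sum>y\<in>C. A x y * v y) - A x a / A x0 a * (\<Sum>y\<in>C. A x0 y * v y)"
        unfolding A'_def sum_distrib_left sum_subtractf[symmetric]
        by (intro sum.cong) (auto simp: algebra_simps)
      ultimately show ?thesis
        using insert.hyps x0 by (simp add: ext_def field_simps)
    qed
    have pivot: "(\<Sum>y\<in>insert a C. A x0 y * ext h v y) = h x0" for h v
      using ext[of x0 h v] x0 by (simp add: A'_def)
    have "\<exists>v. \<forall>x\<in>R - {x0}. (\<Sum>y\<in>C. A' x y * v y) = g x - A x a / A x0 a * g x0"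
    proof (rule insert.IH)
      show "finite (R - {x0})" "card (R - {x0}) \<le> card C"
        using insert.prems insert.hyps x0 by auto
      fix v assume v: "\<And>x. x \<in> R - {x0} \<Longrightarrow> (\<Sum>y\<in>C. A' x y * v y) = 0"
      have "\<forall>y\<in>insert a C. ext (\<lambda>x. 0) v y = 0"
      proof (rule insert.prems(3))
        fix x assume "x \<in> R"
        then show "(\<Sum>y\<in>insert a C. A x y * ext (\<lambda>x. 0) v y) = 0"
          using pivot[of "\<lambda>x. 0" v] ext[of x "\<lambda>x. 0" v] v[of x] by (cases "x = x0") auto
      qed
      then show "\<forall>y\<in>C. v y = 0"
        using insert.hyps by (auto simp: ext_def split: if_splits)
    qed
    then obtain v where
      v: "\<And>x. x \<in> R - {x0} \<Longrightarrow> (\<Sum>y\<in>C. A' x y * v y) = g x - A x a / A x0 a * g x0"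
      by blast
    have "(\<Sum>y\<in>insert a C. A x y * ext g v y) = g x" if "x \<in> R" for x
      using pivot[of g v] ext[of x g v] v[of x] that by (cases "x = x0") auto
    then show ?thesis by blast
  qed simp
qed

section \<open>The random walk generator on the lattice\<close>

text \<open>One step of a nearest-neighbour walk: the jump by s = 1 or -1 along axis i has weight
  1/(2d), plus s \<beta> when i = k, and \<open>F i s\<close> is the value found there.
  \<open>s\<close> is an integer so that jumps read \<open>axis i s\<close>.\<close>

definition nbr_mean :: "'d \<Rightarrow> real \<Rightarrow> ('d \<Rightarrow> int \<Rightarrow> real) \<Rightarrow> real" where
  "nbr_mean k \<beta> F =
     (\<Sum>i\<in>UNIV. 1 / (2 * real CARD('d)) * (F i 1 + F i (-1))) + \<beta> * (F k 1 - F k (-1))"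

lemma nbr_mean_add: "nbr_mean k \<beta> (\<lambda>i s. F i s + G i s) = nbr_mean k \<beta> F + nbr_mean k \<beta> G"
proof -
  have "(\<Sum>i\<in>A. a * (F i 1 + G i 1 + (F i (-1) + G i (-1)))) =
      (\<Sum>i\<in>A. a * (F i 1 + F i (-1))) + (\<Sum>i\<in>A. a * (G i 1 + G i (-1)))" for A and a :: real
    by (simp add: algebra_simps flip: sum.distrib)
  then show ?thesis
    unfolding nbr_mean_def by (simp only:) (simp add: right_diff_distrib distrib_left)
qed

lemma nbr_mean_cmult: "nbr_mean k \<beta> (\<lambda>i s. c * F i s) = c * nbr_mean k \<beta> F"
proof -
  have "(\<Sum>i\<in>A. a * (c * F i 1 + c * F i (-1))) = c * (\<Sum>i\<in>A. a * (F i 1 + F i (-1)))"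
    for A and a :: real
    by (simp add: sum_distrib_left algebra_simps)
  then show ?thesis
    unfolding nbr_mean_def by (simp only:) (simp add: right_diff_distrib distrib_left)
qed

lemma nbr_mean_diff: "nbr_mean k \<beta> (\<lambda>i s. F i s - G i s) = nbr_mean k \<beta> F - nbr_mean k \<beta> G"
  using nbr_mean_add[of k \<beta> F "\<lambda>i s. - 1 * G i s"] nbr_mean_cmult[of k \<beta> "- 1" G] by simp

lemma nbr_mean_sum:
  "nbr_mean k \<beta> (\<lambda>i s. \<Sum>j\<in>A. F j i s) = (\<Sum>j\<in>A. nbr_mean k \<beta> (F j))"
proof (induction A rule: infinite_finite_induct)
  case (insert j A)
  then show ?case by (simp add: nbr_mean_add)
qed (simp_all add: nbr_mean_def)

lemma nbr_mean_weights:
  fixes k :: "'d::finite"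
  defines "p \<equiv> \<lambda>\<beta> i (s::int). 1 / (2 * real CARD('d)) + (if i = k then of_int s * \<beta> else 0)"
  shows "nbr_mean k \<beta> F = (\<Sum>i\<in>UNIV. p \<beta> i 1 * F i 1 + p \<beta> i (-1) * F i (-1))"
    and "(\<Sum>i\<in>UNIV. p \<beta> i 1 + p \<beta> i (-1)) = 1"
proof -
  have "(\<Sum>i\<in>UNIV. p \<beta> i 1 * F i 1 + p \<beta> i (-1) * F i (-1)) =
      (\<Sum>i\<in>UNIV. 1 / (2 * real CARD('d)) * (F i 1 + F i (-1))
         + (if i = k then \<beta> * (F i 1 - F i (-1)) else 0))"
    by (intro sum.cong) (auto simp: p_def algebra_simps add_divide_distrib)
  also have "\<dots> = nbr_mean k \<beta> F"
    by (simp add: nbr_mean_def sum.distrib)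
  finally show "nbr_mean k \<beta> F = (\<Sum>i\<in>UNIV. p \<beta> i 1 * F i 1 + p \<beta> i (-1) * F i (-1))" ..
  have "p \<beta> i 1 + p \<beta> i (-1) = 1 / real CARD('d)" for i
    by (simp add: p_def)
  then show "(\<Sum>i\<in>UNIV. p \<beta> i 1 + p \<beta> i (-1)) = 1"
    by simp
qed

lemma nbr_mean_const: "nbr_mean (k::'d::finite) \<beta> (\<lambda>i s. c) = c"
  by (simp add: nbr_mean_def)

lemma nbr_mean_nonneg:
  fixes k :: "'d::finite"
  assumes "\<bar>\<beta>\<bar> \<le> 1 / (2 * real CARD('d))" and "\<And>i s. s \<in> {1, -1} \<Longrightarrow> 0 \<le> F i s"
  shows "0 \<le> nbr_mean k \<beta> F"
proof -
  have p: "0 \<le> 1 / (2 * real CARD('d)) + (if i = k then of_int s * \<beta> else 0)"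
    if "s \<in> {1, -1}" for i and s :: int
    using that assms(1) by (auto simp: abs_le_iff)
  show ?thesis
    unfolding nbr_mean_weights(1)
    by (rule sum_nonneg, rule add_nonneg_nonneg; rule mult_nonneg_nonneg)
      (auto intro: assms(2) simp only: p insertI1 insertI2 singletonI)
qed

lemma nbr_mean_abs_le:
  fixes k :: "'d::finite"
  assumes "\<bar>\<beta>\<bar> \<le> 1 / (2 * real CARD('d))" and F: "\<And>i s. s \<in> {1, -1} \<Longrightarrow> \<bar>F i s\<bar> \<le> K"
  shows "\<bar>nbr_mean k \<beta> F\<bar> \<le> K"
proof -
  have F': "F i s \<le> K" "- K \<le> F i s" if "s \<in> {1, -1}" for i s
    using F[OF that, of i] by (auto simp only: abs_le_iff)
  have "0 \<le> nbr_mean k \<beta> (\<lambda>i s. K - F i s)" "0 \<le> nbr_mean k \<beta> (\<lambda>i s. F i s - (- K))"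
    by (rule nbr_mean_nonneg[OF assms(1)]; simp only: diff_ge_0_iff_ge F')+
  then show ?thesis
    unfolding nbr_mean_diff nbr_mean_const by linarith
qed

text \<open>The strict bound on \<beta> makes all jump weights positive, so nonnegative values whose
  mean is at most 0 must all vanish. This is the ellipticity behind the strong maximum
  principle.\<close>

lemma nbr_mean_eq_0:
  fixes k :: "'d::finite"
  assumes \<beta>: "\<bar>\<beta>\<bar> < 1 / (2 * real CARD('d))" and nonneg: "\<And>i s. s \<in> {1, -1} \<Longrightarrow> 0 \<le> F i s"
    and le: "nbr_mean k \<beta> F \<le> 0" and s: "s \<in> {1, -1}"
  shows "F i s = 0"
proof -
  define p where "p i (s::int) = 1 / (2 * real CARD('d)) + (if i = k then of_int s * \<beta> else 0)" for i s
  have p: "p i s > 0" if "s \<in> {1, -1}" for i s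
    using that \<beta> by (auto simp: p_def)
  have nn: "0 \<le> p i s * F i s" if "s \<in> {1, -1}" for i s
    using p[OF that, of i] nonneg[OF that, of i] by simp
  have nn2: "0 \<le> p i 1 * F i 1 + p i (-1) * F i (-1)" for i
    using nn[of 1 i] nn[of "- 1" i] by simp
  have "nbr_mean k \<beta> F = (\<Sum>i\<in>UNIV. p i 1 * F i 1 + p i (-1) * F i (-1))"
    unfolding p_def by (rule nbr_mean_weights(1))
  then have "(\<Sum>i\<in>UNIV. p i 1 * F i 1 + p i (-1) * F i (-1)) = 0"
    using le sum_nonneg[of UNIV "\<lambda>i. p i 1 * F i 1 + p i (-1) * F i (-1)", OF nn2] by linarith
  then have "\<forall>i\<in>UNIV. p i 1 * F i 1 + p i (-1) * F i (-1) = 0"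
    using sum_nonneg_eq_0_iff[of UNIV "\<lambda>i. p i 1 * F i 1 + p i (-1) * F i (-1)", OF finite] nn2 by blast
  then have "p i 1 * F i 1 + p i (-1) * F i (-1) = 0"
    by blast
  then have "p i 1 * F i 1 = 0 \<and> p i (-1) * F i (-1) = 0"
    using nn[of 1 i, OF insertI1] nn[of "- 1" i, OF insertI2[OF singletonI]] by linarith
  then have "p i s * F i s = 0"
    using s by blast
  then show ?thesis
    using p[OF s, of i] by simp
qed

definition lattice_gen :: "'d \<Rightarrow> (int ^ 'd \<Rightarrow> real) \<Rightarrow> (int ^ 'd \<Rightarrow> real) \<Rightarrow> int ^ 'd \<Rightarrow> real" where
  "lattice_gen k \<beta> H z = nbr_mean k (\<beta> z) (\<lambda>i s. H (z + axis i s)) - H z"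

lemma lattice_gen_add:
  "lattice_gen k \<beta> (\<lambda>z. G z + H z) z = lattice_gen k \<beta> G z + lattice_gen k \<beta> H z"
  by (simp add: lattice_gen_def nbr_mean_add)

lemma lattice_gen_cmult: "lattice_gen k \<beta> (\<lambda>z. c * H z) z = c * lattice_gen k \<beta> H z"
  by (simp add: lattice_gen_def nbr_mean_cmult algebra_simps)

text \<open>Connectedness of the lattice under unit steps: any multiple of one axis vector is
  reached by integer induction, and z is the sum of its axis components.\<close>

lemma int_vec_induct:
  fixes z :: "int ^ 'd::finite"
  assumes zero: "P 0" and step: "\<And>z i s. s \<in> {1, -1} \<Longrightarrow> P z \<Longrightarrow> P (z + axis i s)"
  shows "P z"
proof -
  have axis_add: "axis i (a + b) = axis i a + axis i b" for i :: 'd and a b :: int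
    by (simp add: vec_eq_iff axis_def)
  have shift: "P (z + axis i n)" if "P z" for z i and n :: int
  proof (induction n rule: int_induct[of _ 0])
    case base
    have *: "axis i 0 = (0 :: int ^ 'd)"
      by (simp add: vec_eq_iff axis_def)
    show ?case using that by (simp add: *)
  next
    case (step1 n)
    then show ?case using step[of 1 "z + axis i n" i] by (simp add: axis_add add.assoc)
  next
    case (step2 n)
    then show ?case
      using step[of "- 1" "z + axis i n" i] axis_add[of i n "- 1"] by (simp add: add.assoc)
  qed
  have "P (\<Sum>i\<in>A. axis i (z $ i))" if "finite A" for A
    using that
  proof (induction A rule: finite_induct)
    case (insert i A)
    then show ?case
      using shift[OF insert.IH, of i "z $ i"] by (simp add: add.commute)
  qed (simp add: zero)
  moreover have "(\<Sum>i\<in>UNIV. axis i (z $ i)) = z"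
    by (simp add: vec_eq_iff axis_def)
  ultimately show ?thesis
    by (metis finite_class.finite_UNIV)
qed

text \<open>
  Fields on the lattice that come from functions on a finite probability space take finitely many
  values, so their maximum is attained and the strong maximum principle needs no compactness.
\<close>

lemma subharmonic_finite_range:
  fixes H :: "int ^ 'd::finite \<Rightarrow> real"
  assumes fin: "finite (range H)" and \<beta>: "\<And>z. \<bar>\<beta> z\<bar> < 1 / (2 * real CARD('d))"
    and sub: "\<And>z. lattice_gen k \<beta> H z \<ge> c"
  shows "c \<le> 0" and "c = 0 \<Longrightarrow> H z = H 0"
proof -
  have "Max (range H) \<in> range H"
    using fin by (intro Max_in) auto
  then obtain m where m: "H m = Max (range H)" by (metis imageE)
  have le: "H y \<le> H m" for y
    unfolding m using fin by (intro Max_ge) auto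
  \<comment> \<open>The generator is minus the mean drop from z to its neighbours, and all drops are
    nonnegative at a maximum point.\<close>
  have gen: "lattice_gen k \<beta> H z = - nbr_mean k (\<beta> z) (\<lambda>i s. H z - H (z + axis i s))" for z
    by (simp add: lattice_gen_def nbr_mean_diff nbr_mean_const)
  have "0 \<le> nbr_mean k (\<beta> m) (\<lambda>i s. H m - H (m + axis i s))"
    by (rule nbr_mean_nonneg) (use \<beta>[of m] le in auto)
  then show "c \<le> 0"
    using sub[of m] unfolding gen by linarith
  assume "c = 0"
  \<comment> \<open>For c = 0 the mean drop at a maximum point is at most 0, so every neighbour is
    again a maximum point, and unit steps reach the whole lattice.\<close>
  have const: "H (m + z) = H m" for z
  proof (induction z rule: int_vec_induct)
    case (2 z i s)
    have "H (m + z) - H (m + z + axis i s) = 0"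
      by (rule nbr_mean_eq_0[OF \<beta>[of "m + z"] _ _ 2(1), of "\<lambda>i s. H (m + z) - H (m + z + axis i s)" k])
        (use 2 le sub[of "m + z"] \<open>c = 0\<close> in \<open>auto simp: gen\<close>)
    then show ?case
      using 2 by (simp add: add.assoc)
  qed simp
  have "H z = H m" "H 0 = H m"
    using const[of "z - m"] const[of "- m"] by simp_all
  then show "H z = H 0" by simp
qed

section \<open>Reflection of the walk\<close>

lemma reflect_add_axis: "reflect k (z + axis i s) = reflect k z + axis i (if i = k then - s else s)"
  by (simp add: reflect_def vec_eq_iff axis_def)

lemma reflect_reflect [simp]: "reflect k (reflect k z) = z"
  by (simp add: reflect_def vec_eq_iff)

text \<open>Reflection exchanges the two jumps along \<open>k\<close>, which is compensated by the
  change of sign of the drift; all other jumps are unaffected.\<close>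

lemma lattice_gen_reflect:
  fixes k :: "'d::finite"
  assumes "\<And>z. \<beta>' (reflect k z) = - \<beta> z"
  shows "lattice_gen k \<beta> (\<lambda>z. H (reflect k z)) z = lattice_gen k \<beta>' H (reflect k z)"
proof -
  let ?r = "reflect k z"
  have "(\<Sum>i\<in>UNIV. 1 / (2 * real CARD('d)) *
        (H (reflect k (z + axis i 1)) + H (reflect k (z + axis i (-1))))) =
      (\<Sum>i\<in>UNIV. 1 / (2 * real CARD('d)) * (H (?r + axis i 1) + H (?r + axis i (-1))))"
    by (intro sum.cong) (auto simp: reflect_add_axis)
  moreover have "\<beta> z * (H (reflect k (z + axis k 1)) - H (reflect k (z + axis k (-1)))) =
      \<beta>' ?r * (H (?r + axis k 1) - H (?r + axis k (-1)))"
    by (simp add: assms reflect_add_axis algebra_simps)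
  ultimately show ?thesis
    unfolding lattice_gen_def nbr_mean_def by (simp only:)
qed

section \<open>Correctors and the effective diffusivity\<close>

text \<open>\<open>transitive\<close> is the form in which ergodicity is used. No measure occurs
  here: the corrector theory needs only a finite space with a transitive action and a small
  drift.\<close>

locale environment =
  fixes \<Omega> :: "'a set" and \<tau> :: "int ^ 'd::finite \<Rightarrow> 'a \<Rightarrow> 'a" and k :: 'd and b :: "'a \<Rightarrow> real"
  assumes finite_space: "finite \<Omega>" and nonempty: "\<Omega> \<noteq> {}"
    and closed: "\<omega> \<in> \<Omega> \<Longrightarrow> \<tau> x \<omega> \<in> \<Omega>"
    and compose: "\<omega> \<in> \<Omega> \<Longrightarrow> \<tau> x (\<tau> y \<omega>) = \<tau> (x + y) \<omega>"
    and zero: "\<omega> \<in> \<Omega> \<Longrightarrow> \<tau> 0 \<omega> = \<omega>"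
    and transitive: "\<omega> \<in> \<Omega> \<Longrightarrow> \<omega>' \<in> \<Omega> \<Longrightarrow> \<exists>x. \<tau> x \<omega> = \<omega>'"
    and b_less: "\<omega> \<in> \<Omega> \<Longrightarrow> \<bar>b \<omega>\<bar> < 1 / (2 * real CARD('d))"
begin

definition env_gen :: "('a \<Rightarrow> real) \<Rightarrow> 'a \<Rightarrow> real" where
  "env_gen h \<omega> = nbr_mean k (b \<omega>) (\<lambda>i s. h (\<tau> (axis i s) \<omega>)) - h \<omega>"

text \<open>First-order coefficient when one jump is applied to h along the orbit times a slowly
  varying function: it multiplies the j-th partial derivative of the latter.\<close>

definition flux :: "('a \<Rightarrow> real) \<Rightarrow> 'd \<Rightarrow> 'a \<Rightarrow> real" where
  "flux h j \<omega> = nbr_mean k (b \<omega>) (\<lambda>i s. if i = j then of_int s * h (\<tau> (axis i s) \<omega>) else 0)"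

lemma env_gen_add: "env_gen (\<lambda>x. g x + h x) \<omega> = env_gen g \<omega> + env_gen h \<omega>"
  by (simp add: env_gen_def nbr_mean_add)

lemma env_gen_cmult: "env_gen (\<lambda>x. c * h x) \<omega> = c * env_gen h \<omega>"
  by (simp add: env_gen_def nbr_mean_cmult algebra_simps)

lemma env_gen_sum: "env_gen (\<lambda>x. \<Sum>j\<in>A. h j x) \<omega> = (\<Sum>j\<in>A. env_gen (h j) \<omega>)"
  by (simp add: env_gen_def nbr_mean_sum sum_subtractf)

lemma env_gen_cong:
  assumes "\<omega> \<in> \<Omega>" "\<And>\<omega>. \<omega> \<in> \<Omega> \<Longrightarrow> g \<omega> = h \<omega>"
  shows "env_gen g \<omega> = env_gen h \<omega>"
  using assms by (simp add: env_gen_def closed)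

lemma lattice_gen_orbit:
  assumes "\<omega> \<in> \<Omega>"
  shows "lattice_gen k (\<lambda>z. b (\<tau> z \<omega>)) (\<lambda>z. h (\<tau> z \<omega>)) z = env_gen h (\<tau> z \<omega>)"
  unfolding lattice_gen_def env_gen_def compose[OF assms] by (simp only: add.commute)

lemma finite_range_orbit: "\<omega> \<in> \<Omega> \<Longrightarrow> finite (range (\<lambda>z. h (\<tau> z \<omega>)))"
  by (rule finite_subset[OF _ finite_imageI[OF finite_space, of h]]) (auto intro: closed)

text \<open>Along an orbit, h becomes a lattice field of finite range, to which the strong maximum
  principle applies; by transitivity one orbit covers the space.\<close>

lemma subharmonic:
  assumes "\<And>\<omega>. \<omega> \<in> \<Omega> \<Longrightarrow> env_gen h \<omega> \<ge> c"
  shows "c \<le> 0" and "c = 0 \<Longrightarrow> \<omega> \<in> \<Omega> \<Longrightarrow> \<omega>' \<in> \<Omega> \<Longrightarrow> h \<omega>' = h \<omega>"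
proof -
  have sub: "lattice_gen k (\<lambda>z. b (\<tau> z \<omega>)) (\<lambda>z. h (\<tau> z \<omega>)) z \<ge> c" if "\<omega> \<in> \<Omega>" for \<omega> z
    unfolding lattice_gen_orbit[OF that] by (intro assms closed that)
  show "c \<le> 0"
    using nonempty subharmonic_finite_range(1)[OF finite_range_orbit b_less sub] closed by blast
  assume "c = 0" and \<omega>: "\<omega> \<in> \<Omega>" "\<omega>' \<in> \<Omega>"
  then obtain z where "\<tau> z \<omega> = \<omega>'"
    using transitive by blast
  then show "h \<omega>' = h \<omega>"
    using subharmonic_finite_range(2)[OF finite_range_orbit[OF \<omega>(1)] b_less[OF closed[OF \<omega>(1)]]
        sub[OF \<omega>(1)] \<open>c = 0\<close>, of z] zero[OF \<omega>(1)] by simp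
qed

text \<open>
  The Fredholm alternative: \<open>h \<mapsto> env_gen h + h \<omega>\<^sub>0\<close> is injective by the strong maximum principle,
  hence onto.
\<close>

lemma cell_problem_solvable:
  obtains h c where "\<And>\<omega>. \<omega> \<in> \<Omega> \<Longrightarrow> env_gen h \<omega> = g \<omega> - c"
proof -
  obtain \<omega>0 where \<omega>0: "\<omega>0 \<in> \<Omega>"
    using nonempty by blast
  \<comment> \<open>Matrix of \<open>env_gen h + h \<omega>0\<close> in the basis of indicator
    functions.\<close>
  define A where "A \<omega> y = env_gen (\<lambda>x. if x = y then 1 else 0) \<omega> + (if y = \<omega>0 then 1 else 0)" for \<omega> y
  have A: "(\<Sum>y\<in>\<Omega>. A \<omega> y * v y) = env_gen v \<omega> + v \<omega>0" if "\<omega> \<in> \<Omega>" for \<omega> v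
  proof -
    have "(\<Sum>y\<in>\<Omega>. env_gen (\<lambda>x. if x = y then 1 else 0) \<omega> * v y)
        = env_gen (\<lambda>x. \<Sum>y\<in>\<Omega>. v y * (if x = y then 1 else 0)) \<omega>"
      by (simp only: env_gen_sum env_gen_cmult mult.commute)
    also have "\<dots> = env_gen v \<omega>"
      by (rule env_gen_cong[OF that]) (simp add: finite_space if_distrib sum.delta' cong: if_cong)
    finally have *: "(\<Sum>y\<in>\<Omega>. env_gen (\<lambda>x. if x = y then 1 else 0) \<omega> * v y) = env_gen v \<omega>" .
    have "(\<Sum>y\<in>\<Omega>. (if y = \<omega>0 then 1 else 0) * v y) = (\<Sum>y\<in>\<Omega>. if y = \<omega>0 then v y else 0)"
      by (intro sum.cong) auto
    also have "\<dots> = v \<omega>0"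
      using \<omega>0 finite_space by simp
    finally show ?thesis
      unfolding A_def distrib_right sum.distrib * by simp
  qed
  have "\<exists>v. \<forall>x\<in>\<Omega>. (\<Sum>y\<in>\<Omega>. A x y * v y) = g x"
  proof (rule linear_system_solvable)
    fix v assume v: "\<And>\<omega>. \<omega> \<in> \<Omega> \<Longrightarrow> (\<Sum>y\<in>\<Omega>. A \<omega> y * v y) = 0"
    have gen: "env_gen v \<omega> = - v \<omega>0" if "\<omega> \<in> \<Omega>" for \<omega>
      using v[OF that] unfolding A[OF that] by simp
    \<comment> \<open>A kernel element has constant generator \<open>- v \<omega>0\<close>. The
      maximum principle for v and for -v makes this constant 0; then v is constant, with value
      \<open>v \<omega>0\<close> = 0.\<close>
    have "- v \<omega>0 \<le> 0"
      by (rule subharmonic(1)[of _ v]) (simp add: gen)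
    moreover have "v \<omega>0 \<le> 0"
      by (rule subharmonic(1)[of _ "\<lambda>x. - 1 * v x"]) (simp only: env_gen_cmult gen; simp)
    ultimately have "v \<omega>0 = 0" by simp
    then show "\<forall>y\<in>\<Omega>. v y = 0"
      using subharmonic(2)[of 0 v \<omega>0] gen \<omega>0 by simp
  qed (use finite_space in auto)
  then obtain v where v: "\<And>x. x \<in> \<Omega> \<Longrightarrow> (\<Sum>y\<in>\<Omega>. A x y * v y) = g x"
    by blast
  show ?thesis
    by (rule that[of v "v \<omega>0"]) (use v A in force)
qed

end

text \<open>Pathwise form of reflection invariance: the drift field seen from \<omega>1 is the
  reflected and negated field seen from \<omega>0. The two points may coincide.\<close>

locale reflected_environment = environment \<Omega> \<tau> k b
  for \<Omega> :: "'a set" and \<tau> :: "int ^ 'd::finite \<Rightarrow> 'a \<Rightarrow> 'a" and k :: 'd and b :: "'a \<Rightarrow> real" +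
  fixes \<omega>0 \<omega>1 :: 'a
  assumes \<omega>0: "\<omega>0 \<in> \<Omega>" and \<omega>1: "\<omega>1 \<in> \<Omega>"
    and reflected: "b (\<tau> (reflect k x) \<omega>1) = - b (\<tau> x \<omega>0)"
begin

text \<open>In the sum of h along the orbit of \<omega>0 and along the reflected orbit of \<omega>1,
  the source g cancels and the generator is -2 c. The maximum principle, applied with both signs,
  gives c = 0; the sum is then harmonic, hence constant.\<close>

lemma antisymmetric_cell_problem:
  assumes g: "\<And>x. g (\<tau> (reflect k x) \<omega>1) = - g (\<tau> x \<omega>0)"
    and h: "\<And>\<omega>. \<omega> \<in> \<Omega> \<Longrightarrow> env_gen h \<omega> = g \<omega> - c"
  shows "c = 0" and "h (\<tau> x \<omega>0) + h (\<tau> (reflect k x) \<omega>1) = h \<omega>0 + h (\<tau> (reflect k 0) \<omega>1)"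
proof -
  let ?H = "\<lambda>x. h (\<tau> x \<omega>0) + h (\<tau> (reflect k x) \<omega>1)"
  have gen: "lattice_gen k (\<lambda>z. b (\<tau> z \<omega>0)) ?H z = - 2 * c" for z
  proof -
    have "lattice_gen k (\<lambda>z. b (\<tau> z \<omega>0)) (\<lambda>x. h (\<tau> (reflect k x) \<omega>1)) z
        = lattice_gen k (\<lambda>z. b (\<tau> z \<omega>1)) (\<lambda>x. h (\<tau> x \<omega>1)) (reflect k z)"
      using lattice_gen_reflect[of "\<lambda>z. b (\<tau> z \<omega>1)" k "\<lambda>z. b (\<tau> z \<omega>0)" "\<lambda>x. h (\<tau> x \<omega>1)" z] reflected
      by simp
    then show ?thesis
      using g[of z]
      by (simp add: lattice_gen_add lattice_gen_orbit \<omega>0 \<omega>1 h closed)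
  qed
  \<comment> \<open>The sum takes values in the image of the finite set of pairs of points; the
    factor \<open>a\<close> covers both signs.\<close>
  have fin: "finite (range (\<lambda>x. a * ?H x))" for a
    by (rule finite_subset[OF _ finite_imageI[OF finite_cartesian_product[OF
            finite_space finite_space], of "\<lambda>(x, y). a * (h x + h y)"]])
      (auto intro!: image_eqI[where x = "(\<tau> x \<omega>0, \<tau> (reflect k x) \<omega>1)" for x] closed \<omega>0 \<omega>1)
  have "- 2 * c \<le> 0"
    using subharmonic_finite_range(1)[of "\<lambda>x. 1 * ?H x" "\<lambda>z. b (\<tau> z \<omega>0)" "- 2 * c" k] fin[of 1]
      b_less[OF closed[OF \<omega>0]] gen by simp
  moreover have "2 * c \<le> 0"
    using subharmonic_finite_range(1)[of "\<lambda>x. - 1 * ?H x" "\<lambda>z. b (\<tau> z \<omega>0)" "2 * c" k] fin[of "- 1"]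
      b_less[OF closed[OF \<omega>0]] gen lattice_gen_cmult[of k "\<lambda>z. b (\<tau> z \<omega>0)" "- 1" ?H] by simp
  ultimately show "c = 0" by simp
  then show "?H x = h \<omega>0 + h (\<tau> (reflect k 0) \<omega>1)"
    using subharmonic_finite_range(2)[of "\<lambda>x. 1 * ?H x" "\<lambda>z. b (\<tau> z \<omega>0)" "- 2 * c" k x] fin[of 1]
      b_less[OF closed[OF \<omega>0]] gen zero[OF \<omega>0] by simp
qed

text \<open>The drift of the coordinate z_k is 2 b, so this \<phi> makes z_k + \<phi> harmonic. The
  source -2 b is itself antisymmetric, so no constant has to be subtracted.\<close>

lemma first_corrector:
  obtains \<phi> C where "\<And>\<omega>. \<omega> \<in> \<Omega> \<Longrightarrow> env_gen \<phi> \<omega> = - 2 * b \<omega>"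
    and "\<And>x. \<phi> (\<tau> (reflect k x) \<omega>1) = C - \<phi> (\<tau> x \<omega>0)"
proof -
  obtain \<phi> c where \<phi>: "\<And>\<omega>. \<omega> \<in> \<Omega> \<Longrightarrow> env_gen \<phi> \<omega> = - 2 * b \<omega> - c"
    using cell_problem_solvable[of "\<lambda>\<omega>. - 2 * b \<omega>"] by blast
  have "- 2 * b (\<tau> (reflect k x) \<omega>1) = - (- 2 * b (\<tau> x \<omega>0))" for x
    by (simp add: reflected)
  note anti = antisymmetric_cell_problem[of "\<lambda>\<omega>. - 2 * b \<omega>" \<phi> c, OF this \<phi>]
  show ?thesis
  proof
    show "env_gen \<phi> \<omega> = - 2 * b \<omega>" if "\<omega> \<in> \<Omega>" for \<omega>
      using \<phi>[OF that] anti(1) by simp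
    show "\<phi> (\<tau> (reflect k x) \<omega>1) = (\<phi> \<omega>0 + \<phi> (\<tau> (reflect k 0) \<omega>1)) - \<phi> (\<tau> x \<omega>0)" for x
      using anti(2)[of x] by simp
  qed
qed

lemma flux_off_axis:
  assumes "j \<noteq> k"
  shows "flux h j \<omega> = 1 / (2 * real CARD('d)) * (h (\<tau> (axis j 1) \<omega>) - h (\<tau> (axis j (-1)) \<omega>))"
proof -
  have "flux h j \<omega> = (\<Sum>i\<in>UNIV. if i = j
      then 1 / (2 * real CARD('d)) * (h (\<tau> (axis j 1) \<omega>) - h (\<tau> (axis j (-1)) \<omega>)) else 0) + b \<omega> * 0"
    unfolding flux_def nbr_mean_def
    by (intro arg_cong2[where f = "(+)"] arg_cong2[where f = "(*)"] sum.cong refl) (use assms in auto)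
  then show ?thesis by simp
qed

text \<open>For j other than k the reflection fixes axis j, so the flux, a difference of \<phi> at
  opposite neighbours, is antisymmetric and the constant C drops out. The solvability constant is
  therefore 0: there is no mixed effective coefficient.\<close>

lemma off_axis_corrector:
  assumes "j \<noteq> k" and \<phi>: "\<And>x. \<phi> (\<tau> (reflect k x) \<omega>1) = C - \<phi> (\<tau> x \<omega>0)"
  obtains \<psi> where "\<And>\<omega>. \<omega> \<in> \<Omega> \<Longrightarrow> env_gen \<psi> \<omega> = - flux \<phi> j \<omega>"
proof -
  obtain \<psi> c where \<psi>: "\<And>\<omega>. \<omega> \<in> \<Omega> \<Longrightarrow> env_gen \<psi> \<omega> = - flux \<phi> j \<omega> - c"
    using cell_problem_solvable[of "\<lambda>\<omega>. - flux \<phi> j \<omega>"] by blast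
  have shift: "\<phi> (\<tau> (axis j s) (\<tau> (reflect k x) \<omega>1)) = C - \<phi> (\<tau> (axis j s) (\<tau> x \<omega>0))" for x s
  proof -
    have "axis j s + reflect k x = reflect k (axis j s + x)"
      using reflect_add_axis[of k x j s] \<open>j \<noteq> k\<close> by (simp add: add.commute)
    then show ?thesis
      by (simp add: compose \<omega>0 \<omega>1 \<phi>)
  qed
  have "- flux \<phi> j (\<tau> (reflect k x) \<omega>1) = - (- flux \<phi> j (\<tau> x \<omega>0))" for x
    unfolding flux_off_axis[OF \<open>j \<noteq> k\<close>] shift by (simp add: algebra_simps)
  then have "c = 0"
    using antisymmetric_cell_problem(1)[of "\<lambda>\<omega>. - flux \<phi> j \<omega>" \<psi> c] \<psi> by blast
  then show ?thesis
    using \<psi> by (intro that[of \<psi>]) simp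
qed

end

section \<open>Positivity of the effective diffusivity\<close>

context environment
begin

text \<open>
  With the harmonic coordinate \<open>\<Phi>(z) = z\<^sub>k + \<phi>(\<tau>\<^sub>z \<omega>)\<close>, the mean squared increment of \<open>\<Phi>\<close> is
  \<open>2 q + env_gen (\<phi>\<^sup>2 - 2 \<psi>)\<close>, and it cannot vanish identically.
\<close>

lemma effective_diffusivity_pos:
  assumes \<phi>: "\<And>\<omega>. \<omega> \<in> \<Omega> \<Longrightarrow> env_gen \<phi> \<omega> = - 2 * b \<omega>"
    and \<psi>: "\<And>\<omega>. \<omega> \<in> \<Omega> \<Longrightarrow> env_gen \<psi> \<omega> = - flux \<phi> k \<omega> + (q - 1 / (2 * real CARD('d)))"
  shows "q > 0"
proof (rule ccontr)
  assume "\<not> q > 0"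
  \<comment> \<open>\<open>e\<close> is the increment of z_k under a jump and \<open>X\<close> the
    value of \<phi> after it, so e + X - \<phi> is the increment of the harmonic coordinate and
    \<open>D\<close> its mean square.\<close>
  define e :: "'d \<Rightarrow> int \<Rightarrow> real" where "e i s = (if i = k then of_int s else 0)" for i s
  define X where "X = (\<lambda>\<omega> i (s::int). \<phi> (\<tau> (axis i s) \<omega>))"
  define D where "D \<omega> = nbr_mean k (b \<omega>) (\<lambda>i s. (e i s + X \<omega> i s - \<phi> \<omega>)\<^sup>2)" for \<omega>
  define h where "h \<omega> = (\<phi> \<omega>)\<^sup>2 + (- 2) * \<psi> \<omega>" for \<omega>
  have D_nonneg: "D \<omega> \<ge> 0" if "\<omega> \<in> \<Omega>" for \<omega>
    unfolding D_def by (rule nbr_mean_nonneg) (use b_less[OF that] in auto)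
  have mean_e: "nbr_mean k \<beta> e = 2 * \<beta>" for \<beta>
    unfolding nbr_mean_def by (subst sum.neutral) (auto simp: e_def)
  have "(\<Sum>i\<in>UNIV. 1 / (2 * real CARD('d)) * ((e i 1)\<^sup>2 + (e i (-1))\<^sup>2)) =
      (\<Sum>i\<in>UNIV. if i = k then 1 / real CARD('d) else 0)"
    by (rule sum.cong) (auto simp: e_def)
  then have mean_e2: "nbr_mean k \<beta> (\<lambda>i s. (e i s)\<^sup>2) = 1 / real CARD('d)" for \<beta>
    unfolding nbr_mean_def by (simp only: sum.delta finite) (simp add: e_def)
  have D: "D \<omega> = env_gen h \<omega> + 2 * q" if \<omega>: "\<omega> \<in> \<Omega>" for \<omega>
  proof -
    have mean_X: "nbr_mean k (b \<omega>) (X \<omega>) = \<phi> \<omega> - 2 * b \<omega>"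
      using \<phi>[OF \<omega>] by (simp add: env_gen_def X_def)
    have mean_eX: "nbr_mean k (b \<omega>) (\<lambda>i s. e i s * X \<omega> i s) = flux \<phi> k \<omega>"
      unfolding flux_def by (rule arg_cong[where f = "nbr_mean k (b \<omega>)"]) (auto simp: e_def X_def fun_eq_iff)
    have mean_X2: "nbr_mean k (b \<omega>) (\<lambda>i s. (X \<omega> i s)\<^sup>2) = env_gen (\<lambda>x. (\<phi> x)\<^sup>2) \<omega> + (\<phi> \<omega>)\<^sup>2"
      by (simp add: env_gen_def X_def)
    have "(\<lambda>i s. (e i s + X \<omega> i s - \<phi> \<omega>)\<^sup>2) =
        (\<lambda>i s. (e i s)\<^sup>2 + (2 * (e i s * X \<omega> i s) + ((- 2 * \<phi> \<omega>) * e i s +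
          ((X \<omega> i s)\<^sup>2 + ((- 2 * \<phi> \<omega>) * X \<omega> i s + (\<phi> \<omega>)\<^sup>2)))))"
      by (simp add: fun_eq_iff power2_eq_square algebra_simps)
    then have "D \<omega> = 1 / real CARD('d) + 2 * flux \<phi> k \<omega> + env_gen (\<lambda>x. (\<phi> x)\<^sup>2) \<omega>"
      unfolding D_def
      by (simp only: nbr_mean_add nbr_mean_cmult nbr_mean_const mean_e mean_e2 mean_X mean_eX mean_X2)
        (simp add: power2_eq_square algebra_simps)
    also have "\<dots> = env_gen h \<omega> + 2 * q"
      unfolding h_def env_gen_add env_gen_cmult \<psi>[OF \<omega>] by (simp add: algebra_simps)
    finally show ?thesis .
  qed
  have sub: "env_gen h \<omega> \<ge> - 2 * q" if "\<omega> \<in> \<Omega>" for \<omega>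
    using D_nonneg[OF that] D[OF that] by simp
  \<comment> \<open>Since D is nonnegative, the generator of h is at least -2 q, so -2 q \<le> 0 by
    the maximum principle. With the contrary assumption q = 0 remains, and then h is
    constant.\<close>
  have "q = 0"
    using subharmonic(1)[OF sub] \<open>\<not> q > 0\<close> by simp
  have gen0: "env_gen h \<omega> = 0" if "\<omega> \<in> \<Omega>" for \<omega>
  proof -
    have "env_gen h \<omega> = env_gen (\<lambda>_. h \<omega>) \<omega>"
      by (rule env_gen_cong[OF that])
        (use subharmonic(2)[OF sub _ that] \<open>q = 0\<close> in auto)
    then show ?thesis
      by (simp add: env_gen_def nbr_mean_const)
  qed
  \<comment> \<open>A vanishing mean square forces every increment to vanish; for the positive jump
    along \<open>k\<close> this makes \<phi> drop by exactly 1, which fails at a minimum over the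
    finite space.\<close>
  have drop: "\<phi> (\<tau> (axis k 1) \<omega>) = \<phi> \<omega> - 1" if "\<omega> \<in> \<Omega>" for \<omega>
  proof -
    have "(e k 1 + X \<omega> k 1 - \<phi> \<omega>)\<^sup>2 = 0"
      by (rule nbr_mean_eq_0[OF b_less[OF that], where F = "\<lambda>i s. (e i s + X \<omega> i s - \<phi> \<omega>)\<^sup>2" and k = k])
        (use D[OF that] gen0[OF that] \<open>q = 0\<close> in \<open>auto simp: D_def\<close>)
    then show ?thesis
      by (simp add: e_def X_def)
  qed
  have "Min (\<phi> ` \<Omega>) \<in> \<phi> ` \<Omega>"
    using finite_space nonempty by (intro Min_in) auto
  then obtain m where m: "m \<in> \<Omega>" "\<phi> m = Min (\<phi> ` \<Omega>)"
    by (metis imageE)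
  then have "\<phi> m \<le> \<phi> (\<tau> (axis k 1) m)"
    using finite_space by (auto intro!: Min_le closed)
  then show False
    using drop[OF m(1)] by simp
qed

end

lemma (in reflected_environment) correctors:
  "\<exists>q>0. \<exists>\<phi> \<psi>. (\<forall>\<omega>\<in>\<Omega>. env_gen \<phi> \<omega> = - 2 * b \<omega>) \<and>
    (\<forall>j. \<forall>\<omega>\<in>\<Omega>. env_gen (\<psi> j) \<omega> =
      - flux \<phi> j \<omega> + (if j = k then q - 1 / (2 * real CARD('d)) else 0))"
proof -
  obtain \<phi> C where \<phi>: "\<And>\<omega>. \<omega> \<in> \<Omega> \<Longrightarrow> env_gen \<phi> \<omega> = - 2 * b \<omega>"
    and anti: "\<And>x. \<phi> (\<tau> (reflect k x) \<omega>1) = C - \<phi> (\<tau> x \<omega>0)"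
    using first_corrector by blast
  obtain \<psi>k c where \<psi>k: "\<And>\<omega>. \<omega> \<in> \<Omega> \<Longrightarrow> env_gen \<psi>k \<omega> = - flux \<phi> k \<omega> - c"
    using cell_problem_solvable[of "\<lambda>\<omega>. - flux \<phi> k \<omega>"] by blast
  \<comment> \<open>Along \<open>k\<close> no antisymmetry is invoked: the solvability constant is
    kept and shifts the bare coefficient 1/(2d) to \<open>q\<close>.\<close>
  define q where "q = 1 / (2 * real CARD('d)) - c"
  have k: "env_gen \<psi>k \<omega> = - flux \<phi> k \<omega> + (q - 1 / (2 * real CARD('d)))" if "\<omega> \<in> \<Omega>" for \<omega>
    using \<psi>k[OF that] by (simp add: q_def)
  have "\<exists>\<psi>. \<forall>\<omega>\<in>\<Omega>. env_gen \<psi> \<omega> =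
      - flux \<phi> j \<omega> + (if j = k then q - 1 / (2 * real CARD('d)) else 0)" for j
  proof (cases "j = k")
    case True
    then show ?thesis using k by auto
  next
    case False
    then obtain \<psi> where "\<And>\<omega>. \<omega> \<in> \<Omega> \<Longrightarrow> env_gen \<psi> \<omega> = - flux \<phi> j \<omega>"
      using off_axis_corrector[OF _ anti] by blast
    then show ?thesis using False by auto
  qed
  then obtain \<psi> where "\<And>j. \<forall>\<omega>\<in>\<Omega>. env_gen (\<psi> j) \<omega> =
      - flux \<phi> j \<omega> + (if j = k then q - 1 / (2 * real CARD('d)) else 0)"
    by metis
  then show ?thesis
    using effective_diffusivity_pos[OF \<phi> k] \<phi> by blast
qed

section \<open>The law of the environment and its reflection\<close>

text \<open>Transitivity holds because an orbit is a nonempty invariant set, which strict ergodicity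
  forces to be the whole space. Finiteness turns the bound on the supremum into pointwise
  bounds.\<close>

lemma environment_of_action:
  fixes M :: "'a measure" and \<tau> :: "int ^ 'd::finite \<Rightarrow> 'a \<Rightarrow> 'a"
  assumes "prob_space M" and fin: "finite (space M)"
    and act: "measure_preserving_action M \<tau>" and erg: "ergodic_action M \<tau>"
    and b: "(SUP \<omega>\<in>space M. \<bar>b \<omega>\<bar>) < 1 / (2 * real CARD('d))"
  shows "environment (space M) \<tau> b"
proof
  have closed: "\<tau> x \<omega> \<in> space M" if "\<omega> \<in> space M" for x \<omega>
    using act that unfolding measure_preserving_action_def by (meson measurable_space)
  have comp: "\<tau> x (\<tau> y \<omega>) = \<tau> (x + y) \<omega>" and zero: "\<tau> 0 \<omega> = \<omega>" if "\<omega> \<in> space M" for x y \<omega>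
    using act that by (auto simp: measure_preserving_action_def)
  show "finite (space M)" "space M \<noteq> {}"
    using fin prob_space.not_empty[OF assms(1)] by auto
  show "\<tau> x \<omega> \<in> space M" "\<tau> x (\<tau> y \<omega>) = \<tau> (x + y) \<omega>" "\<tau> 0 \<omega> = \<omega>"
    if "\<omega> \<in> space M" for x y \<omega>
    using closed comp zero that by auto
  show "\<bar>b \<omega>\<bar> < 1 / (2 * real CARD('d))" if "\<omega> \<in> space M" for \<omega>
    using cSUP_upper[of \<omega> "space M" "\<lambda>\<omega>. \<bar>b \<omega>\<bar>"] fin that b by fastforce
  show "\<exists>x. \<tau> x \<omega> = \<omega>'" if \<omega>: "\<omega> \<in> space M" "\<omega>' \<in> space M" for \<omega> \<omega>'
  proof -
    let ?O = "range (\<lambda>x. \<tau> x \<omega>)"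
    have "\<tau> x ` ?O = ?O" for x
    proof
      show "\<tau> x ` ?O \<subseteq> ?O"
        using comp[OF \<omega>(1)] by auto
      show "?O \<subseteq> \<tau> x ` ?O"
      proof clarify
        fix y
        have "\<tau> y \<omega> = \<tau> x (\<tau> (y - x) \<omega>)"
          using comp[OF \<omega>(1), of x "y - x"] by simp
        then show "\<tau> y \<omega> \<in> \<tau> x ` ?O" by blast
      qed
    qed
    moreover have "?O \<subseteq> space M"
      using closed[OF \<omega>(1)] by blast
    ultimately have "?O = {} \<or> ?O = space M"
      using erg unfolding ergodic_action_def by blast
    then have "\<omega>' \<in> ?O"
      using \<omega>(2) by blast
    then show ?thesis by blast
  qed
qed

text \<open>
  Mixed moments of shifted factors \<open>b \<circ> \<tau>\<^sub>x - c\<close> also determine the joint law; squares of such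
  factors separate the finitely many realizations of the field \<open>x \<mapsto> b (\<tau>\<^sub>x \<omega>)\<close>.
\<close>

lemma reflection_invariant_polynomial:
  assumes "prob_space M" and fin: "finite (space M)" and sets: "sets M = Pow (space M)"
    and inv: "reflection_invariant M \<tau> k b"
  shows "(\<integral>\<omega>. (\<Prod>(x, c)\<leftarrow>cs. b (\<tau> x \<omega>) - c) * (\<Prod>y\<leftarrow>ys. b (\<tau> y \<omega>)) \<partial>M) =
    (\<integral>\<omega>. (\<Prod>(x, c)\<leftarrow>cs. - b (\<tau> (reflect k x) \<omega>) - c) * (\<Prod>y\<leftarrow>ys. - b (\<tau> (reflect k y) \<omega>)) \<partial>M)"
proof (induction cs arbitrary: ys)
  case Nil
  show ?case
  \<comment> \<open>The invariance hypothesis starts at n = 1; for the empty product both integrands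
    are 1.\<close>
  proof (cases "ys = []")
    case False
    have list_prod: "(\<Prod>y\<leftarrow>ys. f y) = (\<Prod>i=1..length ys. f (ys ! (i - 1)))" for f :: "int ^ 'b \<Rightarrow> real"
    proof -
      have "(\<Prod>y\<leftarrow>ys. f y) = (\<Prod>i<length ys. f (ys ! i))"
        by (simp add: prod.list_conv_set_nth atLeast0LessThan)
      also have "\<dots> = (\<Prod>i=1..length ys. f (ys ! (i - 1)))"
        by (rule prod.reindex_bij_witness[of _ "\<lambda>i. i - 1" Suc]) auto
      finally show ?thesis .
    qed
    have "length ys \<ge> 1"
      using False by (simp add: Suc_le_eq)
    then have "(\<integral>\<omega>. (\<Prod>y\<leftarrow>ys. b (\<tau> y \<omega>)) \<partial>M) =
        (- 1) ^ length ys * (\<integral>\<omega>. (\<Prod>y\<leftarrow>ys. b (\<tau> (reflect k y) \<omega>)) \<partial>M)"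
      unfolding list_prod by (rule inv[unfolded reflection_invariant_def, rule_format])
    also have "\<dots> = (\<integral>\<omega>. (- 1) ^ length ys * (\<Prod>y\<leftarrow>ys. b (\<tau> (reflect k y) \<omega>)) \<partial>M)"
      by simp
    also have "\<dots> = (\<integral>\<omega>. (\<Prod>y\<leftarrow>ys. - b (\<tau> (reflect k y) \<omega>)) \<partial>M)"
    proof -
      have "(\<Prod>y\<leftarrow>zs. - b (\<tau> (reflect k y) \<omega>)) =
          (- 1) ^ length zs * (\<Prod>y\<leftarrow>zs. b (\<tau> (reflect k y) \<omega>))" for \<omega> zs
        by (induction zs) auto
      then show ?thesis by simp
    qed
    finally show ?thesis by simp
  qed simp
next
  case (Cons xc cs)
  obtain x c where xc: "xc = (x, c)" by fastforce
  have int: "integrable M f" for f :: "'a \<Rightarrow> real"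
  proof (rule finite_measure.integrable_const_bound[where B = "Max ((\<lambda>\<omega>. \<bar>f \<omega>\<bar>) ` space M)"])
    show "finite_measure M"
      using assms(1) by (simp add: prob_space_def)
    show "f \<in> borel_measurable M"
      using sets by (simp add: measurable_def)
  qed (use fin in auto)
  \<comment> \<open>One factor b - c is multiplied out: its b part joins the plain factors and its
    constant part becomes a scalar. Both integrals have the shorter list \<open>cs\<close>, which is
    why \<open>ys\<close> is arbitrary in the induction.\<close>
  have "(\<integral>\<omega>. (\<Prod>(x, c)\<leftarrow>xc # cs. b (\<tau> x \<omega>) - c) * (\<Prod>y\<leftarrow>ys. b (\<tau> y \<omega>)) \<partial>M) =
      (\<integral>\<omega>. (\<Prod>(x, c)\<leftarrow>cs. b (\<tau> x \<omega>) - c) * (\<Prod>y\<leftarrow>x # ys. b (\<tau> y \<omega>))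
        - c * ((\<Prod>(x, c)\<leftarrow>cs. b (\<tau> x \<omega>) - c) * (\<Prod>y\<leftarrow>ys. b (\<tau> y \<omega>))) \<partial>M)"
    by (simp add: xc algebra_simps)
  also have "\<dots> = (\<integral>\<omega>. (\<Prod>(x, c)\<leftarrow>cs. - b (\<tau> (reflect k x) \<omega>) - c) * (\<Prod>y\<leftarrow>x # ys. - b (\<tau> (reflect k y) \<omega>))
        - c * ((\<Prod>(x, c)\<leftarrow>cs. - b (\<tau> (reflect k x) \<omega>) - c) * (\<Prod>y\<leftarrow>ys. - b (\<tau> (reflect k y) \<omega>))) \<partial>M)"
    by (simp only: Bochner_Integration.integral_diff[OF int int] integral_mult_right_zero Cons.IH)
  also have "\<dots> = (\<integral>\<omega>. (\<Prod>(x, c)\<leftarrow>xc # cs. - b (\<tau> (reflect k x) \<omega>) - c)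
      * (\<Prod>y\<leftarrow>ys. - b (\<tau> (reflect k y) \<omega>)) \<partial>M)"
    by (simp add: xc algebra_simps)
  finally show ?case .
qed

text \<open>Take \<omega>0 of positive mass. If no point realized its reflected and negated field,
  each \<omega>' would differ from it at some site \<open>X \<omega>'\<close>. The product over
  \<omega>' of squared differences from the field of \<omega>' vanishes at every point, yet its
  reflected counterpart is nonnegative and nonzero at \<omega>0, although both have the same
  integral.\<close>

lemma reflected_pair_exists:
  fixes k :: "'d::finite"
  assumes "prob_space M" and fin: "finite (space M)" and sets: "sets M = Pow (space M)"
    and inv: "reflection_invariant M \<tau> k b"
  obtains \<omega>0 \<omega>1 where "\<omega>0 \<in> space M" "\<omega>1 \<in> space M"
    "\<And>x. b (\<tau> (reflect k x) \<omega>1) = - b (\<tau> x \<omega>0)"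
proof -
  interpret prob_space M by fact
  have "emeasure M (space M) = (\<Sum>\<omega>\<in>space M. emeasure M {\<omega>})"
    using fin sets by (intro emeasure_eq_sum_singleton) auto
  then obtain \<omega>0 where \<omega>0: "\<omega>0 \<in> space M" "emeasure M {\<omega>0} \<noteq> 0"
    using emeasure_space_1 by (metis sum.neutral zero_neq_one)
  have "\<exists>\<omega>1\<in>space M. \<forall>x. b (\<tau> x \<omega>1) = - b (\<tau> (reflect k x) \<omega>0)"
  proof (rule ccontr)
    assume "\<not> ?thesis"
    then obtain X where X: "\<And>\<omega>'. \<omega>' \<in> space M \<Longrightarrow> b (\<tau> (X \<omega>') \<omega>') \<noteq> - b (\<tau> (reflect k (X \<omega>')) \<omega>0)"
      by metis
    obtain ws where ws: "set ws = space M"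
      using fin finite_list by blast
    \<comment> \<open>Each factor is listed twice, so that the product consists of squares and is
      nonnegative.\<close>
    define cs where "cs = concat (map (\<lambda>\<omega>'. replicate 2 (X \<omega>', b (\<tau> (X \<omega>') \<omega>'))) ws)"
    have prod_cs: "(\<Prod>(x, c)\<leftarrow>cs. F x - c) = (\<Prod>\<omega>'\<leftarrow>ws. (F (X \<omega>') - b (\<tau> (X \<omega>') \<omega>'))\<^sup>2)"
      for F :: "int ^ 'd \<Rightarrow> real"
      unfolding cs_def by (induction ws) (auto simp: numeral_2_eq_2)
    define G where "G \<omega> = (\<Prod>\<omega>'\<leftarrow>ws. (- b (\<tau> (reflect k (X \<omega>')) \<omega>) - b (\<tau> (X \<omega>') \<omega>'))\<^sup>2)" for \<omega>
    have "(\<integral>\<omega>. G \<omega> \<partial>M) = (\<integral>\<omega>. (\<Prod>\<omega>'\<leftarrow>ws. (b (\<tau> (X \<omega>') \<omega>) - b (\<tau> (X \<omega>') \<omega>'))\<^sup>2) \<partial>M)"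
      using reflection_invariant_polynomial[OF assms, of cs "[]"]
      by (simp add: prod_cs[of "\<lambda>x. b (\<tau> x \<omega>)" for \<omega>] prod_cs[of "\<lambda>x. - b (\<tau> (reflect k x) \<omega>)" for \<omega>] G_def)
    also have "\<dots> = (\<integral>\<omega>. 0 \<partial>M)"
    proof (rule Bochner_Integration.integral_cong[OF refl])
      fix \<omega> assume "\<omega> \<in> space M"
      then have "0 \<in> set (map (\<lambda>\<omega>'. (b (\<tau> (X \<omega>') \<omega>) - b (\<tau> (X \<omega>') \<omega>'))\<^sup>2) ws)"
        unfolding set_map ws by (intro image_eqI[of _ _ \<omega>]) auto
      then show "(\<Prod>\<omega>'\<leftarrow>ws. (b (\<tau> (X \<omega>') \<omega>) - b (\<tau> (X \<omega>') \<omega>'))\<^sup>2) = 0"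
        by (simp only: prod_list_zero_iff)
    qed
    finally have "(\<integral>\<omega>. G \<omega> \<partial>M) = 0" by simp
    moreover have G_nonneg: "G \<omega> \<ge> 0" for \<omega>
      unfolding G_def by (intro prod_list_nonneg) auto
    moreover have "integrable M G"
      by (rule integrable_const_bound[where B = "Max ((\<lambda>\<omega>. \<bar>G \<omega>\<bar>) ` space M)"])
        (use fin sets in \<open>auto simp: measurable_def\<close>)
    ultimately have "AE \<omega> in M. G \<omega> = 0"
      using integral_nonneg_eq_0_iff_AE[of M G] by auto
    then obtain N where N: "{\<omega>\<in>space M. G \<omega> \<noteq> 0} \<subseteq> N" "emeasure M N = 0" "N \<in> sets M"
      by (auto elim: AE_E)
    have "G \<omega>0 \<noteq> 0"
    proof
      assume "G \<omega>0 = 0"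
      then have "0 \<in> (\<lambda>\<omega>'. (- b (\<tau> (reflect k (X \<omega>')) \<omega>0) - b (\<tau> (X \<omega>') \<omega>'))\<^sup>2) ` space M"
        unfolding G_def prod_list_zero_iff set_map ws .
      then show False
      proof (rule imageE)
        fix \<omega>' assume "0 = (- b (\<tau> (reflect k (X \<omega>')) \<omega>0) - b (\<tau> (X \<omega>') \<omega>'))\<^sup>2"
          and "\<omega>' \<in> space M"
        then show False
          using X[of \<omega>'] by simp
      qed
    qed
    then have "emeasure M {\<omega>0} \<le> emeasure M N"
      using N \<omega>0 by (intro emeasure_mono) auto
    then show False
      using N \<omega>0 by simp
  qed
  then obtain \<omega>1 where "\<omega>1 \<in> space M" "\<And>x. b (\<tau> x \<omega>1) = - b (\<tau> (reflect k x) \<omega>0)"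
    by blast
  then show ?thesis
    using that[of \<omega>0 \<omega>1] \<omega>0 by simp
qed

section \<open>Calculus and the elliptic maximum principle\<close>

lemma partial_deriv_eqI:
  assumes "(f has_derivative f') (at x)"
  shows "partial_deriv i f x = f' (axis i 1)"
  using frechet_derivative_at[OF assms] by (simp add: partial_deriv_def)

lemma has_derivative_partial_deriv:
  fixes f :: "real ^ 'd::finite \<Rightarrow> real"
  assumes "f differentiable at x"
  shows "(f has_derivative (\<lambda>e. \<Sum>i\<in>UNIV. e $ i * partial_deriv i f x)) (at x)"
proof -
  have D: "(f has_derivative frechet_derivative f (at x)) (at x)"
    using assms by (simp add: frechet_derivative_works)
  then have lin: "linear (frechet_derivative f (at x))"
    using has_derivative_bounded_linear bounded_linear.linear by blast
  have "frechet_derivative f (at x) e = (\<Sum>i\<in>UNIV. e $ i * partial_deriv i f x)" for e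
  proof -
    have "e = (\<Sum>i\<in>UNIV. e $ i *\<^sub>R axis i 1)"
      using basis_expansion[of e] by (simp add: scalar_mult_eq_scaleR)
    then have "frechet_derivative f (at x) e = frechet_derivative f (at x) (\<Sum>i\<in>UNIV. e $ i *\<^sub>R axis i 1)"
      by simp
    also have "\<dots> = (\<Sum>i\<in>UNIV. e $ i * partial_deriv i f x)"
      by (simp add: linear_sum[OF lin] linear_cmul[OF lin] partial_deriv_def)
    finally show ?thesis .
  qed
  then have "frechet_derivative f (at x) = (\<lambda>e. \<Sum>i\<in>UNIV. e $ i * partial_deriv i f x)"
    by blast
  with D show ?thesis by simp
qed

lemma DERIV_along_axis:
  fixes f :: "real ^ 'd::finite \<Rightarrow> real"
  assumes "f differentiable at (x + t *\<^sub>R axis i 1)"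
  shows "((\<lambda>t. f (x + t *\<^sub>R axis i 1)) has_real_derivative partial_deriv i f (x + t *\<^sub>R axis i 1)) (at t)"
proof -
  have D: "(f has_derivative frechet_derivative f (at (x + t *\<^sub>R axis i 1))) (at (x + t *\<^sub>R axis i 1))"
    using assms by (simp add: frechet_derivative_works)
  have "((\<lambda>t. x + t *\<^sub>R axis i (1::real)) has_derivative (\<lambda>s. s *\<^sub>R axis i 1)) (at t)"
    by (auto intro!: derivative_eq_intros)
  from has_derivative_compose[OF this D]
  have "((\<lambda>t. f (x + t *\<^sub>R axis i 1)) has_derivative
      (\<lambda>s. frechet_derivative f (at (x + t *\<^sub>R axis i 1)) (s *\<^sub>R axis i 1))) (at t)" .
  then show ?thesis
    unfolding has_field_derivative_def
    by (rule has_derivative_eq_rhs)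
      (simp add: fun_eq_iff partial_deriv_def linear_cmul[OF bounded_linear.linear[OF has_derivative_bounded_linear[OF D]]])
qed

lemma partial_deriv_diff:
  fixes f g :: "real ^ 'd::finite \<Rightarrow> real"
  assumes "f differentiable at x" "g differentiable at x"
  shows "partial_deriv i (\<lambda>x. f x - g x) x = partial_deriv i f x - partial_deriv i g x"
  using partial_deriv_eqI[OF has_derivative_diff[OF assms[unfolded frechet_derivative_works]], of i]
  by (simp add: partial_deriv_def)

lemma Ck_diff:
  fixes f g :: "real ^ 'd::finite \<Rightarrow> real"
  assumes "Ck n f" "Ck n g"
  shows "Ck n (\<lambda>x. f x - g x)"
  using assms
proof (induction n arbitrary: f g)
  case 0
  then show ?case by (simp add: continuous_on_diff)
next
  case (Suc n)
  then have "partial_deriv i (\<lambda>x. f x - g x) = (\<lambda>x. partial_deriv i f x - partial_deriv i g x)" for i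
    by (simp add: partial_deriv_diff fun_eq_iff)
  then show ?case
    using Suc by (auto intro: differentiable_diff)
qed

lemma Ck_continuous: "Ck n f \<Longrightarrow> continuous_on UNIV f"
  by (cases n) (auto simp: continuous_on_eq_continuous_at intro!: differentiable_imp_continuous_within)

text \<open>Bounds on all derivatives up to order n over the whole space make the constants in the
  Taylor estimates independent of the base point.\<close>

primrec bounded_Ck :: "nat \<Rightarrow> (real ^ 'd \<Rightarrow> real) \<Rightarrow> bool" where
  "bounded_Ck 0 f \<longleftrightarrow> continuous_on UNIV f \<and> bounded (range f)"
| "bounded_Ck (Suc n) f \<longleftrightarrow>
     (\<forall>x. f differentiable (at x)) \<and> bounded (range f) \<and> (\<forall>i. bounded_Ck n (partial_deriv i f))"

lemma bounded_Ck_bounded: "bounded_Ck n f \<Longrightarrow> bounded (range f)"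
  by (cases n) auto

lemma bounded_Ck_imp_Ck: "bounded_Ck n f \<Longrightarrow> Ck n f"
  by (induction n arbitrary: f) auto

lemma bounded_Ck_Suc_imp: "bounded_Ck (Suc n) f \<Longrightarrow> bounded_Ck n f"
  by (induction n arbitrary: f)
    (auto simp: continuous_on_eq_continuous_at intro!: differentiable_imp_continuous_within)

lemma bounded_Ck_mono: "bounded_Ck n f \<Longrightarrow> m \<le> n \<Longrightarrow> bounded_Ck m f"
  by (induction n arbitrary: m) (auto simp: le_Suc_eq simp del: bounded_Ck.simps dest: bounded_Ck_Suc_imp)

lemma bounded_Ck_funpow: "bounded_Ck (m + n) f \<Longrightarrow> bounded_Ck n ((partial_deriv i ^^ m) f)"
  by (induction m arbitrary: f) (auto simp: funpow_Suc_right simp del: funpow.simps(2))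

text \<open>Off the closed support every derivative vanishes, as the complement is open; on the
  compact support continuity gives boundedness.\<close>

lemma compactly_supported_bounded_Ck:
  fixes f :: "real ^ 'd::finite \<Rightarrow> real"
  assumes "compactly_supported f" "Ck n f"
  shows "bounded_Ck n f"
proof -
  define S where "S = closure {x. f x \<noteq> 0}"
  have S: "compact S"
    using assms(1) by (simp add: compactly_supported_def S_def)
  have "bounded_Ck n g" if "Ck n g" "\<And>x. x \<notin> S \<Longrightarrow> g x = 0" for g
    using that
  proof (induction n arbitrary: g)
    case (0 g)
    then have "compact (g ` S)"
      using S by (intro compact_continuous_image) (auto intro: continuous_on_subset)
    then have "bounded (insert 0 (g ` S))"
      by (simp add: compact_imp_bounded)
    then have "bounded (range g)"
      by (rule bounded_subset) (use 0 in auto)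
    then show ?case using 0 by simp
  next
    case (Suc n g)
    then have "compact (g ` S)"
      using S Ck_continuous[OF Suc.prems(1)] by (intro compact_continuous_image) (auto intro: continuous_on_subset)
    then have "bounded (insert 0 (g ` S))"
      by (simp add: compact_imp_bounded)
    then have bdd: "bounded (range g)"
      by (rule bounded_subset) (use Suc in auto)
    have "partial_deriv i g x = 0" if "x \<notin> S" for i x
    proof -
      have "open (- S)"
        using S by (simp add: compact_imp_closed open_Compl)
      then have "(g has_derivative (\<lambda>e. 0)) (at x)"
        by (rule has_derivative_transform_within_open[OF has_derivative_const[of 0]])
          (use that Suc.prems(2) in auto)
      then show ?thesis
        by (simp add: partial_deriv_eqI)
    qed
    then show ?case
      using Suc bdd by auto
  qed
  from this[OF assms(2)] show ?thesis
    using closure_subset[of "{x. f x \<noteq> 0}"] by (auto simp: S_def)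
qed

text \<open>Maclaurin expansion of the restriction to a line parallel to an axis, with Lagrange
  remainder; the factor 1/n! is estimated by 1.\<close>

lemma taylor_axis:
  fixes f :: "real ^ 'd::finite \<Rightarrow> real"
  assumes f: "bounded_Ck n f" and K: "\<And>x. \<bar>(partial_deriv i ^^ n) f x\<bar> \<le> K"
  shows "\<bar>f (x + s *\<^sub>R axis i 1) - (\<Sum>m<n. (partial_deriv i ^^ m) f x / fact m * s ^ m)\<bar> \<le> K * \<bar>s\<bar> ^ n"
proof -
  define d where "d m t = (partial_deriv i ^^ m) f (x + t *\<^sub>R axis i 1)" for m t
  have "DERIV (d m) t :> d (Suc m) t" if "m < n" for m t
  proof -
    have "bounded_Ck (Suc (n - Suc m)) ((partial_deriv i ^^ m) f)"
      using that f by (intro bounded_Ck_funpow) simp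
    then have "(partial_deriv i ^^ m) f differentiable at (x + t *\<^sub>R axis i 1)"
      by simp
    from DERIV_along_axis[OF this] show ?thesis
      by (simp add: d_def[abs_def])
  qed
  then obtain t where t: "d 0 s = (\<Sum>m<n. d m 0 / fact m * s ^ m) + d n t / fact n * s ^ n"
    using Maclaurin_bi_le[of d "d 0" n s] by blast
  have "\<bar>d n t\<bar> / fact n \<le> \<bar>d n t\<bar> / 1"
    by (intro divide_left_mono) auto
  also have "\<dots> \<le> K"
    using K by (simp add: d_def)
  finally have "\<bar>d n t\<bar> / fact n * \<bar>s\<bar> ^ n \<le> K * \<bar>s\<bar> ^ n"
    by (intro mult_right_mono) auto
  then have "\<bar>d n t / fact n * s ^ n\<bar> \<le> K * \<bar>s\<bar> ^ n"
    by (simp add: abs_mult power_abs)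
  then show ?thesis
    using t by (simp add: d_def)
qed

section \<open>Maximum principle on \<real>^d\<close>

lemma second_deriv_nonpos_at_max:
  fixes \<phi> :: "real \<Rightarrow> real"
  assumes d1: "\<And>t. DERIV \<phi> t :> \<phi>' t" and d2: "DERIV \<phi>' 0 :> l" and max: "\<And>t. \<phi> t \<le> \<phi> 0"
  shows "l \<le> 0"
proof (rule ccontr)
  assume "\<not> l \<le> 0"
  then obtain d where d: "d > 0" "\<And>h. h > 0 \<Longrightarrow> h < d \<Longrightarrow> \<phi>' 0 < \<phi>' (0 + h)"
    using DERIV_pos_inc_right[OF d2] by auto
  have "\<phi>' 0 = 0"
    using DERIV_local_max[OF d1[of 0], of 1] max by simp
  obtain z where z: "0 < z" "z < d / 2" "\<phi> (d / 2) - \<phi> 0 = (d / 2 - 0) * \<phi>' z"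
    using MVT2[of 0 "d / 2" \<phi> \<phi>'] d1 d(1) by auto
  have "\<phi>' z > 0"
    using d(2)[of z] z \<open>\<phi>' 0 = 0\<close> by simp
  then have "\<phi> (d / 2) > \<phi> 0"
    using z(3) d(1) by (metis diff_gt_0_iff_gt diff_zero half_gt_zero mult_pos_pos)
  then show False
    using max[of "d / 2"] by simp
qed

text \<open>
  Since \<open>w\<close> is only bounded, its supremum need not be attained; the penalized function
  \<open>w - \<delta> |x|\<^sup>2\<close> does attain its maximum, and \<open>\<delta>\<close> tends to \<open>0\<close>.
\<close>

lemma elliptic_max_principle:
  fixes w :: "real ^ 'd::finite \<Rightarrow> real"
  assumes w: "Ck 2 w" and bdd: "bounded (range w)" and a: "\<And>i. a i \<ge> 0"
    and res: "\<And>x. w x - (\<Sum>i\<in>UNIV. a i * partial_deriv i (partial_deriv i w) x) \<le> K"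
  shows "w x \<le> K"
proof -
  obtain B where B: "\<And>x. w x \<le> B"
    using bdd by (auto simp: bounded_iff abs_le_iff)
  have diff: "w differentiable at x" "partial_deriv i w differentiable at x" for i x
    using w by (auto simp: numeral_2_eq_2)
  have bound: "w x \<le> K + \<delta> * (2 * sum a UNIV + (norm x)\<^sup>2)" if "\<delta> > 0" for \<delta>
  proof -
    define \<phi> where "\<phi> y = w y - \<delta> * (norm y)\<^sup>2" for y
    \<comment> \<open>Outside the ball of radius r the penalty exceeds \<open>B - \<phi> x\<close>,
      so \<phi> stays below \<open>\<phi> x\<close> there; as the ball contains x, the maximum over
      it is global.\<close>
    define r where "r = max (norm x) (sqrt ((\<bar>B - \<phi> x\<bar> + 1) / \<delta>))"
    have "r\<^sup>2 \<ge> (sqrt ((\<bar>B - \<phi> x\<bar> + 1) / \<delta>))\<^sup>2"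
      unfolding r_def using \<open>\<delta> > 0\<close> by (intro power_mono) auto
    then have r: "\<delta> * r\<^sup>2 > B - \<phi> x"
      using \<open>\<delta> > 0\<close> by (simp add: field_simps)
    have "continuous_on (cball 0 r) \<phi>"
      unfolding \<phi>_def using Ck_continuous[OF w]
      by (intro continuous_intros) (auto intro: continuous_on_subset)
    moreover have "x \<in> cball 0 r"
      by (simp add: r_def)
    ultimately obtain y where y: "y \<in> cball 0 r" "\<And>z. z \<in> cball 0 r \<Longrightarrow> \<phi> z \<le> \<phi> y"
      using continuous_attains_sup[of "cball 0 r" \<phi>] by (metis compact_cball empty_iff)
    have max: "\<phi> z \<le> \<phi> y" for z
    proof (cases "z \<in> cball 0 r")
      case False
      then have "r\<^sup>2 \<le> (norm z)\<^sup>2"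
        by (intro power_mono) (auto simp: r_def le_max_iff_disj)
      then have "\<delta> * r\<^sup>2 \<le> \<delta> * (norm z)\<^sup>2"
        using \<open>\<delta> > 0\<close> by simp
      then have "\<phi> z \<le> \<phi> x"
        using B[of z] r unfolding \<phi>_def[of z] by linarith
      then show ?thesis
        using y(2)[of x] \<open>x \<in> cball 0 r\<close> by simp
    qed (use y in auto)
    \<comment> \<open>Along each axis \<phi> has a maximum at t = 0, and the penalty contributes -2
      \<delta> to the second derivative.\<close>
    have second: "partial_deriv i (partial_deriv i w) y \<le> 2 * \<delta>" for i
    proof -
      have norm_sq: "(norm (y + t *\<^sub>R axis i 1))\<^sup>2 = (norm y)\<^sup>2 + 2 * t * y $ i + t\<^sup>2" for t
        unfolding power2_norm_eq_inner
        by (simp add: inner_add_left inner_add_right inner_axis inner_axis' power2_eq_square algebra_simps)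
      have "partial_deriv i (partial_deriv i w) (y + 0 *\<^sub>R axis i 1) - 2 * \<delta> \<le> 0"
      proof (rule second_deriv_nonpos_at_max)
        show "DERIV (\<lambda>t. \<phi> (y + t *\<^sub>R axis i 1)) t :>
            partial_deriv i w (y + t *\<^sub>R axis i 1) - \<delta> * (2 * y $ i + 2 * t)" for t
          unfolding \<phi>_def norm_sq
          by (rule derivative_eq_intros DERIV_along_axis diff refl | simp)+
        show "DERIV (\<lambda>t. partial_deriv i w (y + t *\<^sub>R axis i 1) - \<delta> * (2 * y $ i + 2 * t)) 0 :>
            partial_deriv i (partial_deriv i w) (y + 0 *\<^sub>R axis i 1) - 2 * \<delta>"
          by (rule derivative_eq_intros DERIV_along_axis diff refl | simp)+
        show "\<phi> (y + t *\<^sub>R axis i 1) \<le> \<phi> (y + 0 *\<^sub>R axis i 1)" for t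
          using max by simp
      qed
      then show ?thesis by simp
    qed
    have "(\<Sum>i\<in>UNIV. a i * partial_deriv i (partial_deriv i w) y) \<le> (\<Sum>i\<in>UNIV. a i * (2 * \<delta>))"
      by (intro sum_mono mult_left_mono second a)
    then have "w y \<le> K + 2 * \<delta> * sum a UNIV"
      using res[of y] by (simp add: sum_distrib_right[symmetric] mult.commute)
    moreover have "\<phi> y \<le> w y"
      using \<open>\<delta> > 0\<close> by (simp add: \<phi>_def)
    ultimately show ?thesis
      using max[of x] by (simp add: \<phi>_def algebra_simps)
  qed
  let ?c = "2 * sum a UNIV + (norm x)\<^sup>2"
  have c: "?c \<ge> 0"
    using a by (simp add: sum_nonneg)
  show ?thesis
  proof (rule field_le_epsilon)
    fix e :: real assume "e > 0"
    then have "e / (?c + 1) * ?c \<le> e"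
      using c by (simp add: field_simps)
    then show "w x \<le> K + e"
      using bound[of "e / (?c + 1)"] c \<open>e > 0\<close> by simp
  qed
qed

lemma elliptic_max_principle_abs:
  fixes u v :: "real ^ 'd::finite \<Rightarrow> real"
  assumes u: "Ck 2 u" "bounded (range u)" and v: "Ck 2 v" "bounded (range v)" and a: "\<And>i. a i \<ge> 0"
    and res: "\<And>x. \<bar>(u x - (\<Sum>i\<in>UNIV. a i * partial_deriv i (partial_deriv i u) x)) -
        (v x - (\<Sum>i\<in>UNIV. a i * partial_deriv i (partial_deriv i v) x))\<bar> \<le> K"
  shows "\<bar>u x - v x\<bar> \<le> K"
proof -
  have le: "f x - g x \<le> K" if f: "Ck 2 f" "bounded (range f)" and g: "Ck 2 g" "bounded (range g)"
    and r: "\<And>x. (f x - (\<Sum>i\<in>UNIV. a i * partial_deriv i (partial_deriv i f) x)) -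
        (g x - (\<Sum>i\<in>UNIV. a i * partial_deriv i (partial_deriv i g) x)) \<le> K" for f g
  proof (rule elliptic_max_principle[OF Ck_diff[OF f(1) g(1)] bounded_minus_comp[OF f(2) g(2)] a])
    fix x
    have "partial_deriv i (\<lambda>x. f x - g x) = (\<lambda>x. partial_deriv i f x - partial_deriv i g x)" for i
      using f(1) g(1) by (simp add: fun_eq_iff partial_deriv_diff numeral_2_eq_2)
    moreover have "partial_deriv i (\<lambda>x. partial_deriv i f x - partial_deriv i g x) x =
        partial_deriv i (partial_deriv i f) x - partial_deriv i (partial_deriv i g) x" for i
      using f(1) g(1) by (simp add: partial_deriv_diff numeral_2_eq_2)
    ultimately show "f x - g x - (\<Sum>i\<in>UNIV. a i * partial_deriv i (partial_deriv i (\<lambda>x. f x - g x)) x) \<le> K"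
      using r[of x] by (simp add: right_diff_distrib sum_subtractf)
  qed
  show ?thesis
    using le[OF u v] le[OF v u] res by (simp add: abs_le_iff)
qed

section \<open>The homogenized equation\<close>

locale elliptic =
  fixes a :: "'d::finite \<Rightarrow> real"
  assumes a_pos: "a i > 0"
begin

text \<open>Defined at every point of \<real>^d rather than on a grid, so that the scheme commutes
  with translations and hence with differentiation.\<close>

definition shift_mean :: "real \<Rightarrow> (real ^ 'd \<Rightarrow> real) \<Rightarrow> real ^ 'd \<Rightarrow> real" where
  "shift_mean h v x =
     (\<Sum>i\<in>UNIV. a i / (2 * sum a UNIV) * (v (x + h *\<^sub>R axis i 1) + v (x + (- h) *\<^sub>R axis i 1)))"

lemma sum_a_pos: "sum a UNIV > 0"
  using a_pos by (intro sum_pos) auto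

sublocale shift: sup_contraction "shift_mean h" for h
proof
  show "shift_mean h (\<lambda>y. u y - v y) x = shift_mean h u x - shift_mean h v x" for u v x
    unfolding shift_mean_def sum_subtractf[symmetric] by (simp add: algebra_simps)
  show "\<bar>shift_mean h v x\<bar> \<le> K" if v: "\<And>y. \<bar>v y\<bar> \<le> K" for v x K
  proof -
    have "\<bar>shift_mean h v x\<bar> \<le> (\<Sum>i\<in>UNIV. a i / (2 * sum a UNIV) * (2 * K))"
      unfolding shift_mean_def
    proof (rule order_trans[OF sum_abs sum_mono])
      fix i
      have "\<bar>v (x + h *\<^sub>R axis i 1) + v (x + (- h) *\<^sub>R axis i 1)\<bar> \<le> 2 * K"
        using v[of "x + h *\<^sub>R axis i 1"] v[of "x + (- h) *\<^sub>R axis i 1"] by linarith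
      then show "\<bar>a i / (2 * sum a UNIV) * (v (x + h *\<^sub>R axis i 1) + v (x + (- h) *\<^sub>R axis i 1))\<bar>
          \<le> a i / (2 * sum a UNIV) * (2 * K)"
        using a_pos[of i] sum_a_pos unfolding abs_mult by (intro mult_mono) auto
    qed
    also have "\<dots> = K"
      using sum_a_pos by (simp flip: sum_distrib_right sum_divide_distrib)
    finally show ?thesis .
  qed
qed

text \<open>Normalization for which (\<open>shift_mean h v\<close> - v) / \<kappa> is the sum over i
  of a i times the second difference quotient of v with step h.\<close>

definition \<kappa> :: "real \<Rightarrow> real" where
  "\<kappa> h = h\<^sup>2 / (2 * sum a UNIV)"

abbreviation "iter h m g \<equiv> shift.resolvent_iterate h (\<kappa> h) g m"

lemma has_derivative_shift_mean:
  assumes "\<And>x. (v has_derivative v' x) (at x)"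
  shows "(shift_mean h v has_derivative (\<lambda>e. shift_mean h (\<lambda>x. v' x e) x)) (at x)"
proof -
  have "((\<lambda>x. v (x + c)) has_derivative v' (x + c)) (at x)" for x c
  proof -
    have "((\<lambda>x. x + c) has_derivative (\<lambda>e. e)) (at x)"
      by (auto intro!: derivative_eq_intros)
    from has_derivative_compose[OF this assms] show ?thesis by simp
  qed
  then show ?thesis
    unfolding shift_mean_def[abs_def]
    by (intro has_derivative_sum has_derivative_mult_right has_derivative_add)
qed

text \<open>Shifts and linear combinations commute with differentiation, so the derivative of an
  iterate in a fixed direction is the iterate of that derivative.\<close>

lemma has_derivative_iter:
  assumes g: "\<And>x. (g has_derivative g' x) (at x)"
  shows "(iter h m g has_derivative (\<lambda>e. iter h m (\<lambda>x. g' x e) x)) (at x)"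
proof (induction m arbitrary: x)
  case (Suc m)
  show ?case
    unfolding shift.resolvent_iterate.simps divide_inverse
    by (intro has_derivative_mult_left has_derivative_add has_derivative_mult_right g
        has_derivative_shift_mean Suc)
qed simp

lemma differentiable_iter: "(\<And>x. g differentiable (at x)) \<Longrightarrow> iter h m g differentiable (at x)"
  using has_derivative_iter[OF iffD1[OF frechet_derivative_works]] differentiableI by blast

lemma partial_deriv_iter:
  assumes "\<And>x. g differentiable (at x)"
  shows "partial_deriv i (iter h m g) = iter h m (partial_deriv i g)"
proof
  fix x
  have D: "(g has_derivative frechet_derivative g (at x)) (at x)" for x
    using assms by (simp add: frechet_derivative_works)
  show "partial_deriv i (iter h m g) x = iter h m (partial_deriv i g) x"
    using partial_deriv_eqI[OF has_derivative_iter[OF D], of i] by (simp add: partial_deriv_def[abs_def])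
qed

lemma continuous_iter:
  assumes "continuous_on UNIV g"
  shows "continuous_on UNIV (iter h m g)"
proof (induction m)
  case (Suc m)
  have "continuous_on UNIV (\<lambda>x. iter h m g (x + c))" for c
    by (rule continuous_on_compose2[OF Suc]) (auto intro: continuous_intros)
  then have "continuous_on UNIV (shift_mean h (iter h m g))"
    unfolding shift_mean_def by (intro continuous_intros)
  then show ?case
    unfolding shift.resolvent_iterate.simps divide_inverse
    by (intro continuous_intros assms)
qed simp

lemma \<kappa>_pos: "h > 0 \<Longrightarrow> \<kappa> h > 0"
  using sum_a_pos by (simp add: \<kappa>_def)

lemma bounded_iter:
  assumes "h > 0" "bounded (range g)"
  shows "bounded (range (iter h m g))"
proof -
  obtain K where "\<And>x. \<bar>g x\<bar> \<le> K"
    using assms(2) by (auto simp: bounded_iff)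
  then have "\<bar>iter h m g x\<bar> \<le> K" for x
    using shift.resolvent_iterate_bound[OF \<kappa>_pos[OF assms(1)]] by blast
  then show ?thesis
    by (auto simp: bounded_iff)
qed

lemma bounded_Ck_iter: "h > 0 \<Longrightarrow> bounded_Ck n g \<Longrightarrow> bounded_Ck n (iter h m g)"
  by (induction n arbitrary: g)
    (simp_all add: continuous_iter bounded_iter differentiable_iter partial_deriv_iter)

lemma partial_deriv_funpow_iter:
  assumes "bounded_Ck n g" "j \<le> n"
  shows "(partial_deriv i ^^ j) (iter h m g) = iter h m ((partial_deriv i ^^ j) g)"
  using assms
proof (induction j arbitrary: n g)
  case (Suc j)
  then obtain n' where n': "n = Suc n'" by (cases n) auto
  with Suc have "partial_deriv i (iter h m g) = iter h m (partial_deriv i g)"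
    by (intro partial_deriv_iter) simp
  then show ?case
    using Suc.IH[of n' "partial_deriv i g"] Suc.prems n' by (simp add: funpow_Suc_right del: funpow.simps(2))
qed simp

section \<open>Consistency of the difference scheme\<close>

abbreviation mesh :: "nat \<Rightarrow> real" where
  "mesh n \<equiv> 1 / real (Suc n)"

text \<open>The number of iterations makes the residual of the scheme at mesh \<open>h\<close> of order \<open>h\<close>.\<close>

definition steps :: "nat \<Rightarrow> nat" where
  "steps n = (SOME m. (1 + \<kappa> (mesh n)) * (1 / (1 + \<kappa> (mesh n))) ^ m \<le> \<kappa> (mesh n) * mesh n)"

text \<open>Finitely many iterations stand in for the exact solution of the scheme, so commuting
  with derivatives requires no passage to the limit.\<close>

definition approx :: "nat \<Rightarrow> (real ^ 'd \<Rightarrow> real) \<Rightarrow> real ^ 'd \<Rightarrow> real" where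
  "approx n = (\<lambda>g. iter (mesh n) (steps n) g)"

lemma steps: "(1 + \<kappa> (mesh n)) * (1 / (1 + \<kappa> (mesh n))) ^ steps n \<le> \<kappa> (mesh n) * mesh n"
proof -
  let ?k = "\<kappa> (mesh n)"
  have k: "?k > 0"
    by (rule \<kappa>_pos) simp
  then have "1 / (1 + ?k) < 1" "?k * mesh n / (1 + ?k) > 0"
    by (simp_all add: divide_simps)
  then obtain m where "(1 / (1 + ?k)) ^ m < ?k * mesh n / (1 + ?k)"
    using real_arch_pow_inv by blast
  then have "(1 / (1 + ?k)) ^ m * (1 + ?k) < ?k * mesh n"
    using k by (subst (asm) pos_less_divide_eq) simp_all
  then have "(1 + ?k) * (1 / (1 + ?k)) ^ m \<le> ?k * mesh n"
    by (simp only: mult.commute[of "1 + ?k"] less_imp_le)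
  then show ?thesis
    unfolding steps_def by (rule someI)
qed

lemma approx_bound: "(\<And>x. \<bar>g x\<bar> \<le> K) \<Longrightarrow> \<bar>approx n g x\<bar> \<le> K"
  unfolding approx_def by (rule shift.resolvent_iterate_bound[OF \<kappa>_pos]) auto

lemma bounded_Ck_approx: "bounded_Ck m g \<Longrightarrow> bounded_Ck m (approx n g)"
  unfolding approx_def by (rule bounded_Ck_iter) auto

text \<open>One further iterate w satisfies (1 + \<kappa>) w = \<open>shift_mean h v\<close> +
  \<kappa> g exactly. Replacing w by v costs (1 + \<kappa>) |w - v|, which the choice of
  \<open>steps\<close> keeps below \<kappa> K h; dividing by \<kappa> leaves K h.\<close>

lemma approx_residual:
  fixes n :: nat
  assumes g: "\<And>x. \<bar>g x\<bar> \<le> K"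
  defines "h \<equiv> mesh n" and "v \<equiv> approx n g"
  shows "\<bar>v x - (\<Sum>i\<in>UNIV. a i * (v (x + h *\<^sub>R axis i 1) + v (x + (- h) *\<^sub>R axis i 1) - 2 * v x) / h\<^sup>2) - g x\<bar>
    \<le> K * h"
proof -
  let ?k = "\<kappa> h" and ?A = "sum a UNIV"
  have h: "h > 0"
    by (simp add: h_def)
  have k: "?k > 0"
    using \<kappa>_pos[OF h] .
  have K: "K \<ge> 0"
    using g[of x] by linarith
  define w where "w = iter h (Suc (steps n)) g"
  have "\<bar>w x - v x\<bar> \<le> K * (1 / (1 + ?k)) ^ steps n"
    unfolding w_def v_def approx_def h_def
    by (rule shift.resolvent_iterate_increment[OF \<kappa>_pos g]) simp
  then have "(1 + ?k) * \<bar>w x - v x\<bar> \<le> K * ((1 + ?k) * (1 / (1 + ?k)) ^ steps n)"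
    using k mult_left_mono[of "\<bar>w x - v x\<bar>" _ "1 + ?k"] by (simp add: mult.left_commute)
  also have "\<dots> \<le> K * (?k * h)"
    using steps[of n] K unfolding h_def by (rule mult_left_mono)
  finally have incr: "(1 + ?k) * \<bar>w x - v x\<bar> \<le> ?k * (K * h)"
    by (simp add: mult_ac)
  have "(1 + ?k) * w x = shift_mean h v x + ?k * g x"
    using k unfolding w_def v_def approx_def h_def by simp
  moreover have "shift_mean h v x - v x =
      ?k * (\<Sum>i\<in>UNIV. a i * (v (x + h *\<^sub>R axis i 1) + v (x + (- h) *\<^sub>R axis i 1) - 2 * v x) / h\<^sup>2)"
  proof -
    have "shift_mean h v x - v x = shift_mean h v x - (\<Sum>i\<in>UNIV. a i / (2 * ?A) * (2 * v x))"
      using sum_a_pos by (simp flip: sum_distrib_right sum_divide_distrib)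
    also have "\<dots> = (\<Sum>i\<in>UNIV. a i / (2 * ?A) *
        (v (x + h *\<^sub>R axis i 1) + v (x + (- h) *\<^sub>R axis i 1) - 2 * v x))"
      unfolding shift_mean_def by (simp only: right_diff_distrib sum_subtractf)
    also have "\<dots> =
      ?k * (\<Sum>i\<in>UNIV. a i * (v (x + h *\<^sub>R axis i 1) + v (x + (- h) *\<^sub>R axis i 1) - 2 * v x) / h\<^sup>2)"
      unfolding sum_distrib_left[of "\<kappa> h"] using h by (intro sum.cong) (auto simp: \<kappa>_def)
    finally show ?thesis .
  qed
  moreover define r where "r = v x -
      (\<Sum>i\<in>UNIV. a i * (v (x + h *\<^sub>R axis i 1) + v (x + (- h) *\<^sub>R axis i 1) - 2 * v x) / h\<^sup>2) - g x"
  ultimately have eq: "(1 + ?k) * (w x - v x) = - (?k * r)"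
    unfolding r_def right_diff_distrib distrib_right by linarith
  have "?k * \<bar>r\<bar> = \<bar>(1 + ?k) * (w x - v x)\<bar>"
    unfolding eq abs_minus_cancel abs_mult using k by simp
  also have "\<dots> = (1 + ?k) * \<bar>w x - v x\<bar>"
    unfolding abs_mult using k by simp
  finally have "\<bar>r\<bar> \<le> K * h"
    using incr k by (metis mult_le_cancel_left_pos)
  then show ?thesis
    by (simp only: r_def)
qed

text \<open>In the two third-order Taylor expansions at h and -h the linear terms cancel; the
  remainders add up to 2 K h^3 before division by h^2.\<close>

lemma second_difference:
  assumes v: "bounded_Ck 3 v" and K: "\<And>x. \<bar>(partial_deriv i ^^ 3) v x\<bar> \<le> K" and h: "h > 0"
  shows "\<bar>(v (x + h *\<^sub>R axis i 1) + v (x + (- h) *\<^sub>R axis i 1) - 2 * v x) / h\<^sup>2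
    - partial_deriv i (partial_deriv i v) x\<bar> \<le> 2 * K * h"
proof -
  let ?d = "v (x + h *\<^sub>R axis i 1) + v (x + (- h) *\<^sub>R axis i 1) - 2 * v x
      - h\<^sup>2 * partial_deriv i (partial_deriv i v) x"
  have taylor: "\<bar>v (x + s *\<^sub>R axis i 1) - (v x + s * partial_deriv i v x
      + s\<^sup>2 / 2 * partial_deriv i (partial_deriv i v) x)\<bar> \<le> K * \<bar>s\<bar> ^ 3" for s
    using taylor_axis[OF v K, of x s] by (simp add: numeral_3_eq_3 power2_eq_square algebra_simps)
  have "\<bar>?d\<bar> \<le> 2 * K * h ^ 3"
    using taylor[of h] taylor[of "- h"] h by (simp add: power2_eq_square field_simps abs_le_iff)
  then have "\<bar>?d\<bar> / h\<^sup>2 \<le> 2 * K * h ^ 3 / h\<^sup>2"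
    by (rule divide_right_mono) simp
  also have "\<dots> = 2 * K * h"
    using h by (simp add: power3_eq_cube power2_eq_square)
  also have "\<bar>?d\<bar> / h\<^sup>2 = \<bar>?d / h\<^sup>2\<bar>"
    by simp
  also have "?d / h\<^sup>2 = (v (x + h *\<^sub>R axis i 1) + v (x + (- h) *\<^sub>R axis i 1) - 2 * v x) / h\<^sup>2
    - partial_deriv i (partial_deriv i v) x"
    using h by (simp add: diff_divide_distrib)
  finally show ?thesis .
qed

text \<open>The third derivatives of all approximations are bounded by those of g, because they are
  approximations for the third derivatives of g. Hence \<open>second_difference\<close> applies with
  constants independent of n.\<close>

lemma approx_equation:
  assumes g: "bounded_Ck 3 g"
  obtains C where "\<And>n x. \<bar>approx n g x - (\<Sum>i\<in>UNIV. a i * partial_deriv i (partial_deriv i (approx n g)) x) - g x\<bar>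
    \<le> C * mesh n"
proof -
  have "\<exists>K. \<forall>x. \<bar>(partial_deriv i ^^ 3) g x\<bar> \<le> K" for i
    using bounded_Ck_bounded[OF bounded_Ck_funpow[of 3 0 g i]] g by (auto simp: bounded_iff)
  then obtain K3 where K3: "\<And>i x. \<bar>(partial_deriv i ^^ 3) g x\<bar> \<le> K3 i"
    by metis
  obtain K where K: "\<And>x. \<bar>g x\<bar> \<le> K"
    using bounded_Ck_bounded[OF g] by (auto simp: bounded_iff)
  show ?thesis
  proof
    fix n x
    let ?v = "approx n g" and ?h = "mesh n"
    have v: "bounded_Ck 3 ?v"
      using g by (rule bounded_Ck_approx)
    have v3: "\<bar>(partial_deriv i ^^ 3) ?v x\<bar> \<le> K3 i" for i x
      unfolding approx_def partial_deriv_funpow_iter[OF g order_refl]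
      by (rule approx_bound[unfolded approx_def, OF K3])
    let ?D = "\<lambda>i. (?v (x + ?h *\<^sub>R axis i 1) + ?v (x + (- ?h) *\<^sub>R axis i 1) - 2 * ?v x) / ?h\<^sup>2"
    have "\<bar>(\<Sum>i\<in>UNIV. a i * ?D i) - (\<Sum>i\<in>UNIV. a i * partial_deriv i (partial_deriv i ?v) x)\<bar>
        \<le> (\<Sum>i\<in>UNIV. a i * (2 * K3 i * ?h))"
      unfolding sum_subtractf[symmetric] right_diff_distrib[symmetric]
    proof (rule order_trans[OF sum_abs sum_mono])
      fix i
      show "\<bar>a i * (?D i - partial_deriv i (partial_deriv i ?v) x)\<bar> \<le> a i * (2 * K3 i * ?h)"
        unfolding abs_mult abs_of_pos[OF a_pos]
        by (intro mult_left_mono second_difference[OF v v3] less_imp_le[OF a_pos]) simp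
    qed
    also have "\<dots> = (\<Sum>i\<in>UNIV. a i * (2 * K3 i)) * ?h"
      unfolding sum_distrib_right by (simp add: mult_ac)
    finally have "\<bar>(\<Sum>i\<in>UNIV. a i * ?D i) - (\<Sum>i\<in>UNIV. a i * partial_deriv i (partial_deriv i ?v) x)\<bar>
        \<le> (\<Sum>i\<in>UNIV. a i * (2 * K3 i)) * ?h" .
    moreover have "\<bar>?v x - (\<Sum>i\<in>UNIV. a i * ?D i) - g x\<bar> \<le> K * ?h"
      using approx_residual[of g K n x, OF K] by (simp only: times_divide_eq_right)
    ultimately show "\<bar>?v x - (\<Sum>i\<in>UNIV. a i * partial_deriv i (partial_deriv i ?v) x) - g x\<bar>
        \<le> (K + (\<Sum>i\<in>UNIV. a i * (2 * K3 i))) * ?h"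
      unfolding distrib_right by linarith
  qed
qed

section \<open>The limit of vanishing mesh\<close>

definition resolvent :: "(real ^ 'd \<Rightarrow> real) \<Rightarrow> real ^ 'd \<Rightarrow> real" where
  "resolvent g x = lim (\<lambda>n. approx n g x)"

lemma mesh_tendsto: "(\<lambda>n. C * mesh n) \<longlonglongrightarrow> 0"
proof -
  have "mesh \<longlonglongrightarrow> 0"
    using LIMSEQ_inverse_real_of_nat by (simp add: inverse_eq_divide)
  from tendsto_mult_left[OF this, of C] show ?thesis by simp
qed

text \<open>Two approximations solve the same elliptic equation up to errors C \<open>mesh n\<close>
  and C \<open>mesh m\<close>, so the maximum principle on \<real>^d makes the sequence uniformly
  Cauchy with an explicit rate.\<close>

lemma approx_tendsto_resolvent:
  assumes g: "bounded_Ck 3 g"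
  obtains C where "\<And>n x. \<bar>approx n g x - resolvent g x\<bar> \<le> C * mesh n"
    and "\<And>x. (\<lambda>n. approx n g x) \<longlonglongrightarrow> resolvent g x"
proof -
  obtain C where C: "\<And>n x. \<bar>approx n g x -
      (\<Sum>i\<in>UNIV. a i * partial_deriv i (partial_deriv i (approx n g)) x) - g x\<bar> \<le> C * mesh n"
    using approx_equation[OF g] by blast
  have Ck2: "Ck 2 (approx n g)" "bounded (range (approx n g))" for n
    using bounded_Ck_approx[OF g, of n] bounded_Ck_mono[of 3 "approx n g" 2]
    by (auto intro: bounded_Ck_imp_Ck bounded_Ck_bounded)
  have cauchy: "\<bar>approx n g x - approx m g x\<bar> \<le> C * mesh n + C * mesh m" for n m x
  proof (rule elliptic_max_principle_abs[OF Ck2 Ck2])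
    show "a i \<ge> 0" for i
      using a_pos[of i] by simp
    show "\<bar>(approx n g x - (\<Sum>i\<in>UNIV. a i * partial_deriv i (partial_deriv i (approx n g)) x)) -
        (approx m g x - (\<Sum>i\<in>UNIV. a i * partial_deriv i (partial_deriv i (approx m g)) x))\<bar>
        \<le> C * mesh n + C * mesh m" for x
      using C[of n x] C[of m x] by linarith
  qed
  have lim: "(\<lambda>n. approx n g x) \<longlonglongrightarrow> resolvent g x" for x
  proof -
    have "Cauchy (\<lambda>n. approx n g x)"
    proof (rule metric_CauchyI)
      fix e :: real assume "e > 0"
      then obtain N where N: "\<And>n. n \<ge> N \<Longrightarrow> C * mesh n < e / 2"
        using order_tendstoD(2)[OF mesh_tendsto[of C], of "e / 2"] by (auto simp: eventually_sequentially)
      have "dist (approx m g x) (approx n g x) < e" if "m \<ge> N" "n \<ge> N" for m n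
        using cauchy[of m x n] N[OF that(1)] N[OF that(2)] by (simp only: dist_real_def)
      then show "\<exists>N. \<forall>m\<ge>N. \<forall>n\<ge>N. dist (approx m g x) (approx n g x) < e"
        by blast
    qed
    then show ?thesis
      unfolding resolvent_def by (intro iffD1[OF convergent_LIMSEQ_iff] real_Cauchy_convergent)
  qed
  have "\<bar>approx n g x - resolvent g x\<bar> \<le> C * mesh n" for n x
  proof (rule LIMSEQ_le)
    show "(\<lambda>m. \<bar>approx n g x - approx m g x\<bar>) \<longlonglongrightarrow> \<bar>approx n g x - resolvent g x\<bar>"
      by (intro tendsto_intros lim)
    show "(\<lambda>m. C * mesh n + C * mesh m) \<longlonglongrightarrow> C * mesh n"
      using tendsto_add[OF tendsto_const mesh_tendsto[of C]] by simp
  qed (use cauchy in blast)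
  with lim show ?thesis
    using that by blast
qed

text \<open>The partial derivatives of the approximations are the approximations for the partial
  derivatives of g and converge uniformly, so the limit may be differentiated termwise. Order 4
  leaves order 3 for the differentiated data.\<close>

lemma has_derivative_resolvent:
  assumes g: "bounded_Ck 4 g"
  shows "(resolvent g has_derivative (\<lambda>e. \<Sum>i\<in>UNIV. e $ i * resolvent (partial_deriv i g) x)) (at x)"
proof -
  have g4: "bounded_Ck (Suc 3) g"
    using g by (simp add: eval_nat_numeral)
  then have g3: "bounded_Ck 3 g" "bounded_Ck 3 (partial_deriv i g)" for i
    using bounded_Ck_Suc_imp unfolding bounded_Ck.simps by blast+
  have "\<exists>C. \<forall>n x. \<bar>approx n (partial_deriv i g) x - resolvent (partial_deriv i g) x\<bar> \<le> C * mesh n" for i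
    using approx_tendsto_resolvent[OF g3(2)] by metis
  then obtain C where C: "\<And>i n x. \<bar>approx n (partial_deriv i g) x - resolvent (partial_deriv i g) x\<bar>
      \<le> C i * mesh n"
    by metis
  have D: "(approx n g has_derivative (\<lambda>e. \<Sum>i\<in>UNIV. e $ i * approx n (partial_deriv i g) x)) (at x)" for n x
  proof -
    have diff: "\<And>x. g differentiable (at x)"
      using g4 unfolding bounded_Ck.simps by blast
    have "approx n g differentiable (at x)"
      unfolding approx_def by (rule differentiable_iter) (rule diff)
    from has_derivative_partial_deriv[OF this] show ?thesis
      unfolding approx_def partial_deriv_iter[OF diff] .
  qed
  have "\<exists>G. \<forall>x\<in>UNIV. (\<lambda>n. approx n g x) \<longlonglongrightarrow> G x \<and>
      (G has_derivative (\<lambda>e. \<Sum>i\<in>UNIV. e $ i * resolvent (partial_deriv i g) x)) (at x)"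
  proof (rule has_derivative_sequence[OF convex_UNIV D])
    show "(\<lambda>n. approx n g x) \<longlonglongrightarrow> resolvent g x"
      using approx_tendsto_resolvent[OF g3(1)] by blast
    fix e :: real assume "e > 0"
    then have "\<forall>\<^sub>F n in sequentially. sum C UNIV * mesh n < e"
      by (rule order_tendstoD(2)[OF mesh_tendsto])
    then show "\<forall>\<^sub>F n in sequentially. \<forall>x\<in>UNIV. \<forall>y. norm ((\<Sum>i\<in>UNIV. y $ i * approx n (partial_deriv i g) x)
        - (\<Sum>i\<in>UNIV. y $ i * resolvent (partial_deriv i g) x)) \<le> e * norm y"
    proof eventually_elim
      case (elim n)
      show ?case
      proof (intro ballI allI)
        fix x y
        have "\<bar>\<Sum>i\<in>UNIV. y $ i * (approx n (partial_deriv i g) x - resolvent (partial_deriv i g) x)\<bar>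
            \<le> (\<Sum>i\<in>UNIV. norm y * (C i * mesh n))"
        proof (rule order_trans[OF sum_abs sum_mono])
          fix i
          show "\<bar>y $ i * (approx n (partial_deriv i g) x - resolvent (partial_deriv i g) x)\<bar>
              \<le> norm y * (C i * mesh n)"
            unfolding abs_mult using component_le_norm_cart[of y i] C[of n i x]
            by (intro mult_mono) auto
        qed
        also have "\<dots> = (sum C UNIV * mesh n) * norm y"
          by (simp only: sum_distrib_left sum_distrib_right mult_ac)
        also have "\<dots> \<le> e * norm y"
          using elim by (intro mult_right_mono) auto
        finally show "norm ((\<Sum>i\<in>UNIV. y $ i * approx n (partial_deriv i g) x)
            - (\<Sum>i\<in>UNIV. y $ i * resolvent (partial_deriv i g) x)) \<le> e * norm y"
          by (simp only: real_norm_def sum_subtractf right_diff_distrib)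
      qed
    qed
  qed auto
  then obtain G where G: "\<And>x. (\<lambda>n. approx n g x) \<longlonglongrightarrow> G x"
    "\<And>x. (G has_derivative (\<lambda>e. \<Sum>i\<in>UNIV. e $ i * resolvent (partial_deriv i g) x)) (at x)"
    by auto
  have "G = resolvent g"
    using limI[OF G(1)] by (simp add: fun_eq_iff resolvent_def)
  then show ?thesis
    using G(2) by simp
qed

lemma partial_deriv_resolvent:
  assumes "bounded_Ck 4 g"
  shows "partial_deriv i (resolvent g) = resolvent (partial_deriv i g)"
proof
  fix x
  have "(\<Sum>j\<in>UNIV. axis i 1 $ j * resolvent (partial_deriv j g) x) =
      (\<Sum>j\<in>UNIV. if j = i then resolvent (partial_deriv j g) x else 0)"
    by (intro sum.cong) (auto simp: axis_def)
  then show "partial_deriv i (resolvent g) x = resolvent (partial_deriv i g) x"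
    unfolding partial_deriv_eqI[OF has_derivative_resolvent[OF assms]] by simp
qed

lemma bounded_resolvent:
  assumes "bounded_Ck 3 g"
  shows "bounded (range (resolvent g))"
proof -
  obtain K where K: "\<And>x. \<bar>g x\<bar> \<le> K"
    using bounded_Ck_bounded[OF assms] by (auto simp: bounded_iff)
  have "(\<lambda>n. approx n g x) \<longlonglongrightarrow> resolvent g x" for x
    using approx_tendsto_resolvent[OF assms] by blast
  then have "\<bar>resolvent g x\<bar> \<le> K" for x
    by (rule LIMSEQ_le_const2[OF tendsto_rabs]) (use approx_bound[OF K] in auto)
  then show ?thesis
    by (auto simp: bounded_iff)
qed

text \<open>Every derivative is moved onto g by \<open>partial_deriv_resolvent\<close>, which asks
  for order 4; this loss of derivatives is harmless for smooth g.\<close>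

lemma bounded_Ck_resolvent: "bounded_Ck (n + 4) g \<Longrightarrow> bounded_Ck n (resolvent g)"
proof (induction n arbitrary: g)
  case 0
  then have g: "bounded_Ck 4 g" by simp
  have "bounded (range (resolvent g))"
    using bounded_resolvent[OF bounded_Ck_mono[OF g]] by simp
  moreover have "continuous_on UNIV (resolvent g)"
    using has_derivative_continuous[OF has_derivative_resolvent[OF g]]
    by (simp add: continuous_on_eq_continuous_at)
  ultimately show ?case by simp
next
  case (Suc n)
  have g: "bounded_Ck 4 g"
    using bounded_Ck_mono[OF Suc.prems, of 4] by simp
  have "bounded (range (resolvent g))"
    using bounded_resolvent[OF bounded_Ck_mono[OF g]] by simp
  moreover have "resolvent g differentiable (at x)" for x
    using has_derivative_resolvent[OF g] differentiableI by blast
  moreover have "bounded_Ck n (resolvent (partial_deriv i g))" for i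
    by (rule Suc.IH) (use Suc.prems in \<open>unfold add_Suc bounded_Ck.simps, blast\<close>)
  ultimately show ?case
    by (simp add: partial_deriv_resolvent[OF g])
qed

text \<open>Once the second derivatives are moved onto g, the approximate equation involves only
  approximations, and each of them converges pointwise.\<close>

lemma resolvent_equation:
  assumes g: "bounded_Ck 6 g"
  shows "resolvent g x - (\<Sum>i\<in>UNIV. a i * partial_deriv i (partial_deriv i (resolvent g)) x) = g x"
proof -
  have g': "bounded_Ck (Suc 5) g" "bounded_Ck 5 (partial_deriv i g)" for i
    using g by (simp_all add: eval_nat_numeral)
  have g'': "bounded_Ck 4 (partial_deriv i (partial_deriv i g))" for i
    using g'(2)[of i] by (simp add: eval_nat_numeral)
  have le: "bounded_Ck 3 g" "bounded_Ck 4 g" "bounded_Ck 4 (partial_deriv i g)"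
    "bounded_Ck 3 (partial_deriv i (partial_deriv i g))" for i
    using bounded_Ck_mono[OF g] bounded_Ck_mono[OF g'(2)[of i]] bounded_Ck_mono[OF g''[of i]] by auto
  obtain C where C: "\<And>n x. \<bar>approx n g x -
      (\<Sum>i\<in>UNIV. a i * partial_deriv i (partial_deriv i (approx n g)) x) - g x\<bar> \<le> C * mesh n"
    using approx_equation[OF le(1)] by blast
  have commute: "partial_deriv i (partial_deriv i (approx n g)) = approx n (partial_deriv i (partial_deriv i g))"
    for i n
    using partial_deriv_funpow_iter[OF g, of 2 i "mesh n" "steps n"] by (simp add: approx_def numeral_2_eq_2)
  have lim: "(\<lambda>n. approx n f x) \<longlonglongrightarrow> resolvent f x" if "bounded_Ck 3 f" for f
    using approx_tendsto_resolvent[OF that] by blast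
  let ?E = "\<lambda>n. approx n g x - (\<Sum>i\<in>UNIV. a i * approx n (partial_deriv i (partial_deriv i g)) x) - g x"
  have "?E \<longlonglongrightarrow>
      resolvent g x - (\<Sum>i\<in>UNIV. a i * resolvent (partial_deriv i (partial_deriv i g)) x) - g x"
    by (intro tendsto_intros lim le)
  moreover have "?E \<longlonglongrightarrow> 0"
    by (rule Lim_null_comparison[OF _ mesh_tendsto[of C]]) (use C in \<open>auto simp: commute\<close>)
  ultimately have "resolvent g x - (\<Sum>i\<in>UNIV. a i * resolvent (partial_deriv i (partial_deriv i g)) x) - g x = 0"
    using LIMSEQ_unique by blast
  then show ?thesis
    by (simp add: partial_deriv_resolvent le)
qed

end

section \<open>The two-scale expansion\<close>

lemma lattice_point_add_axis:
  "lattice_point \<epsilon> (z + axis i s) = lattice_point \<epsilon> z + (\<epsilon> * real_of_int s) *\<^sub>R axis i 1"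
  by (simp add: lattice_point_def vec_eq_iff axis_def algebra_simps)

lemma inj_lattice_point: "\<epsilon> \<noteq> 0 \<Longrightarrow> inj (lattice_point \<epsilon>)"
  by (auto simp: inj_def lattice_point_def vec_eq_iff)

lemma taylor_uniform:
  fixes v :: "real ^ 'd::finite \<Rightarrow> real"
  assumes v: "bounded_Ck n v"
  shows "\<exists>K. \<forall>x s i. \<bar>v (x + s *\<^sub>R axis i 1) -
    (\<Sum>m<n. (partial_deriv i ^^ m) v x / fact m * s ^ m)\<bar> \<le> K * \<bar>s\<bar> ^ n"
proof -
  have "\<exists>K. \<forall>x. \<bar>(partial_deriv i ^^ n) v x\<bar> \<le> K" for i
    using bounded_Ck_bounded[OF bounded_Ck_funpow[of n 0 v i]] v by (auto simp: bounded_iff)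
  then obtain K where K: "\<And>i x. \<bar>(partial_deriv i ^^ n) v x\<bar> \<le> K i"
    by metis
  have K_nonneg: "K i \<ge> 0" for i
    using K[of i 0] by linarith
  have "K i \<le> sum K UNIV" for i
    using K_nonneg by (intro member_le_sum) auto
  then have K': "\<bar>(partial_deriv i ^^ n) v x\<bar> \<le> sum K UNIV" for i x
    using K order_trans by blast
  show ?thesis
    using taylor_axis[OF v K'] by blast
qed

section \<open>Taylor expansion under the walk mean\<close>

lemma nbr_mean_odd:
  fixes k :: "'d::finite"
  shows "nbr_mean k \<beta> (\<lambda>i s. of_int s * c i) = 2 * \<beta> * c k"
  by (simp add: nbr_mean_def)

lemma nbr_mean_even:
  fixes k :: "'d::finite"
  shows "nbr_mean k \<beta> (\<lambda>i s. c i) = (\<Sum>i\<in>UNIV. 1 / real CARD('d) * c i)"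
  unfolding nbr_mean_def by (simp add: field_simps flip: sum_divide_distrib)

text \<open>The number in the name is the order of the Taylor remainder. The versions 3, 2 and 1 are
  meant for the terms of the ansatz of size 1, \<epsilon> and \<epsilon>^2, so that each leaves an
  error of order \<epsilon>^3.\<close>

lemma nbr_mean_expansion3:
  fixes k :: "'d::finite"
  assumes K: "\<And>x s i. \<bar>u (x + s *\<^sub>R axis i 1) -
      (\<Sum>m<3. (partial_deriv i ^^ m) u x / fact m * s ^ m)\<bar> \<le> K * \<bar>s\<bar> ^ 3"
    and \<epsilon>: "0 \<le> \<epsilon>" and \<beta>: "\<bar>\<beta>\<bar> \<le> 1 / (2 * real CARD('d))"
  shows "\<bar>nbr_mean k \<beta> (\<lambda>i s. u (x + (\<epsilon> * of_int s) *\<^sub>R axis i 1)) - (u x + \<epsilon> * (2 * \<beta> * partial_deriv k u x)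
       + \<epsilon>\<^sup>2 * (\<Sum>i\<in>UNIV. 1 / (2 * real CARD('d)) * partial_deriv i (partial_deriv i u) x))\<bar> \<le> K * \<epsilon> ^ 3"
proof -
  let ?u1 = "\<lambda>i. partial_deriv i u x" and ?u2 = "\<lambda>i. partial_deriv i (partial_deriv i u) x"
  let ?T = "\<lambda>i s. u x + (\<epsilon> * (of_int s * ?u1 i) + \<epsilon>\<^sup>2 * (1 / 2 * ?u2 i))"
  have "\<bar>nbr_mean k \<beta> (\<lambda>i s. u (x + (\<epsilon> * of_int s) *\<^sub>R axis i 1) - ?T i s)\<bar> \<le> K * \<epsilon> ^ 3"
  proof (rule nbr_mean_abs_le[OF \<beta>])
    fix i and s :: int assume s: "s \<in> {1, - 1}"
    show "\<bar>u (x + (\<epsilon> * of_int s) *\<^sub>R axis i 1) - ?T i s\<bar> \<le> K * \<epsilon> ^ 3"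
      using s K[of x "\<epsilon> * of_int s" i] \<epsilon>
      by (auto simp: numeral_3_eq_3 power2_eq_square algebra_simps)
  qed
  also have "nbr_mean k \<beta> (\<lambda>i s. u (x + (\<epsilon> * of_int s) *\<^sub>R axis i 1) - ?T i s) =
      nbr_mean k \<beta> (\<lambda>i s. u (x + (\<epsilon> * of_int s) *\<^sub>R axis i 1)) -
      (u x + (\<epsilon> * (2 * \<beta> * ?u1 k) + \<epsilon>\<^sup>2 * (1 / 2 * (\<Sum>i\<in>UNIV. 1 / real CARD('d) * ?u2 i))))"
    by (simp only: nbr_mean_diff nbr_mean_add nbr_mean_cmult nbr_mean_const nbr_mean_odd nbr_mean_even)
  also have "1 / 2 * (\<Sum>i\<in>UNIV. 1 / real CARD('d) * ?u2 i) =
      (\<Sum>i\<in>UNIV. 1 / (2 * real CARD('d)) * ?u2 i)"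
    by (simp add: sum_distrib_left)
  finally show "\<bar>nbr_mean k \<beta> (\<lambda>i s. u (x + (\<epsilon> * of_int s) *\<^sub>R axis i 1)) - (u x + \<epsilon> * (2 * \<beta> * ?u1 k)
     + \<epsilon>\<^sup>2 * (\<Sum>i\<in>UNIV. 1 / (2 * real CARD('d)) * ?u2 i))\<bar> \<le> K * \<epsilon> ^ 3"
    by (simp only: add.assoc)
qed

text \<open>With a rapidly varying factor X, the order \<epsilon> term collects, for each direction
  j, the mean of s X over the jumps along j. For X built from \<phi> these means are the
  fluxes.\<close>

lemma nbr_mean_expansion2:
  fixes k :: "'d::finite"
  assumes K: "\<And>x s i. \<bar>v (x + s *\<^sub>R axis i 1) -
      (\<Sum>m<2. (partial_deriv i ^^ m) v x / fact m * s ^ m)\<bar> \<le> K * \<bar>s\<bar>\<^sup>2"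
    and \<beta>: "\<bar>\<beta>\<bar> \<le> 1 / (2 * real CARD('d))" and X: "\<And>i s. \<bar>X i s\<bar> \<le> B"
  shows "\<bar>nbr_mean k \<beta> (\<lambda>i s. X i s * v (x + (\<epsilon> * of_int s) *\<^sub>R axis i 1)) - (v x * nbr_mean k \<beta> X
       + \<epsilon> * (\<Sum>j\<in>UNIV. partial_deriv j v x * nbr_mean k \<beta> (\<lambda>i s. if i = j then of_int s * X i s else 0)))\<bar>
      \<le> B * K * \<epsilon>\<^sup>2"
proof -
  let ?F = "\<lambda>j i s. if i = j then of_int s * X i s else 0"
  let ?T = "\<lambda>i s. v x * X i s + \<epsilon> * (\<Sum>j\<in>UNIV. partial_deriv j v x * ?F j i s)"
  have "\<bar>nbr_mean k \<beta> (\<lambda>i s. X i s * v (x + (\<epsilon> * of_int s) *\<^sub>R axis i 1) - ?T i s)\<bar> \<le> B * K * \<epsilon>\<^sup>2"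
  proof (rule nbr_mean_abs_le[OF \<beta>])
    fix i and s :: int assume s: "s \<in> {1, - 1}"
    have taylor: "\<bar>v (x + (\<epsilon> * of_int s) *\<^sub>R axis i 1) - (v x + partial_deriv i v x * (\<epsilon> * of_int s))\<bar>
        \<le> K * \<epsilon>\<^sup>2"
      using s K[of x "\<epsilon> * of_int s" i] by (auto simp: numeral_2_eq_2)
    have "(\<Sum>j\<in>UNIV. partial_deriv j v x * ?F j i s) =
        (\<Sum>j\<in>UNIV. if i = j then partial_deriv j v x * (of_int s * X i s) else 0)"
      by (intro sum.cong) auto
    also have "\<dots> = partial_deriv i v x * (of_int s * X i s)"
      by simp
    finally have "X i s * v (x + (\<epsilon> * of_int s) *\<^sub>R axis i 1) - ?T i s =
        X i s * (v (x + (\<epsilon> * of_int s) *\<^sub>R axis i 1) - (v x + partial_deriv i v x * (\<epsilon> * of_int s)))"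
      by (simp add: algebra_simps)
    also have "\<bar>\<dots>\<bar> \<le> B * (K * \<epsilon>\<^sup>2)"
      unfolding abs_mult[of "X i s"] using X[of i s] by (intro mult_mono taylor) auto
    finally show "\<bar>X i s * v (x + (\<epsilon> * of_int s) *\<^sub>R axis i 1) - ?T i s\<bar> \<le> B * K * \<epsilon>\<^sup>2"
      by (simp only: mult.assoc)
  qed
  then show "\<bar>nbr_mean k \<beta> (\<lambda>i s. X i s * v (x + (\<epsilon> * of_int s) *\<^sub>R axis i 1)) - (v x * nbr_mean k \<beta> X
     + \<epsilon> * (\<Sum>j\<in>UNIV. partial_deriv j v x * nbr_mean k \<beta> (?F j)))\<bar> \<le> B * K * \<epsilon>\<^sup>2"
    by (simp only: nbr_mean_diff nbr_mean_add nbr_mean_cmult nbr_mean_sum)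
qed

lemma nbr_mean_expansion1:
  fixes k :: "'d::finite"
  assumes K: "\<And>x s i. \<bar>v (x + s *\<^sub>R axis i 1) -
      (\<Sum>m<1. (partial_deriv i ^^ m) v x / fact m * s ^ m)\<bar> \<le> K * \<bar>s\<bar> ^ 1"
    and \<epsilon>: "0 \<le> \<epsilon>" and \<beta>: "\<bar>\<beta>\<bar> \<le> 1 / (2 * real CARD('d))" and X: "\<And>i s. \<bar>X i s\<bar> \<le> B"
  shows "\<bar>nbr_mean k \<beta> (\<lambda>i s. X i s * v (x + (\<epsilon> * of_int s) *\<^sub>R axis i 1)) - v x * nbr_mean k \<beta> X\<bar>
      \<le> B * K * \<epsilon>"
proof -
  have "\<bar>nbr_mean k \<beta> (\<lambda>i s. X i s * v (x + (\<epsilon> * of_int s) *\<^sub>R axis i 1) - v x * X i s)\<bar> \<le> B * K * \<epsilon>"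
  proof (rule nbr_mean_abs_le[OF \<beta>])
    fix i and s :: int assume "s \<in> {1, - 1}"
    then have s: "\<bar>real_of_int s\<bar> = 1"
      by auto
    have "X i s * v (x + (\<epsilon> * of_int s) *\<^sub>R axis i 1) - v x * X i s =
        X i s * (v (x + (\<epsilon> * of_int s) *\<^sub>R axis i 1) - v x)"
      by (simp add: algebra_simps)
    also have "\<bar>\<dots>\<bar> \<le> B * (K * \<epsilon>)"
      unfolding abs_mult using X[of i s] K[of x "\<epsilon> * of_int s" i] s \<epsilon>
      by (intro mult_mono) (auto simp: abs_mult)
    finally show "\<bar>X i s * v (x + (\<epsilon> * of_int s) *\<^sub>R axis i 1) - v x * X i s\<bar> \<le> B * K * \<epsilon>"
      by (simp only: mult.assoc)
  qed
  then show "\<bar>nbr_mean k \<beta> (\<lambda>i s. X i s * v (x + (\<epsilon> * of_int s) *\<^sub>R axis i 1)) - v x * nbr_mean k \<beta> X\<bar>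
      \<le> B * K * \<epsilon>"
    by (simp only: nbr_mean_diff nbr_mean_cmult)
qed

lemma lipschitz_of_bounded_Ck:
  fixes u :: "real ^ 'd::finite \<Rightarrow> real"
  assumes u: "bounded_Ck 1 u"
  obtains L where "\<And>x y. \<bar>u x - u y\<bar> \<le> L * norm (x - y)"
proof -
  have "\<exists>K. \<forall>x. \<bar>partial_deriv i u x\<bar> \<le> K" for i
    using bounded_Ck_bounded[OF bounded_Ck_funpow[of 1 0 u i]] u by (auto simp: bounded_iff)
  then obtain K where K: "\<And>i x. \<bar>partial_deriv i u x\<bar> \<le> K i"
    by metis
  have D: "(u has_derivative (\<lambda>e. \<Sum>i\<in>UNIV. e $ i * partial_deriv i u x)) (at x)" for x
    using u by (intro has_derivative_partial_deriv) simp
  have "onorm (\<lambda>e. \<Sum>i\<in>UNIV. e $ i * partial_deriv i u x) \<le> sum K UNIV" for x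
  proof (rule onorm_le)
    fix e :: "real ^ 'd"
    have "\<bar>\<Sum>i\<in>UNIV. e $ i * partial_deriv i u x\<bar> \<le> (\<Sum>i\<in>UNIV. norm e * K i)"
    proof (rule order_trans[OF sum_abs sum_mono])
      show "\<bar>e $ i * partial_deriv i u x\<bar> \<le> norm e * K i" for i
        unfolding abs_mult using component_le_norm_cart[of e i] K[of i x] by (intro mult_mono) auto
    qed
    then show "norm (\<Sum>i\<in>UNIV. e $ i * partial_deriv i u x) \<le> sum K UNIV * norm e"
      by (simp add: sum_distrib_left mult.commute)
  qed
  then have "norm (u x - u y) \<le> sum K UNIV * norm (x - y)" for x y
    by (intro differentiable_bound[OF convex_UNIV D]) auto
  then show ?thesis
    using that by auto
qed

lemma norm_lattice_point_floor:
  fixes x :: "real ^ 'd::finite"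
  assumes "\<epsilon> > 0"
  shows "norm (lattice_point \<epsilon> (floor_vec (x /\<^sub>R \<epsilon>)) - x) \<le> real CARD('d) * \<epsilon>"
proof -
  have "\<bar>(lattice_point \<epsilon> (floor_vec (x /\<^sub>R \<epsilon>)) - x) $ i\<bar> \<le> \<epsilon>" for i
  proof -
    have "(lattice_point \<epsilon> (floor_vec (x /\<^sub>R \<epsilon>)) - x) $ i = \<epsilon> * (real_of_int \<lfloor>x $ i / \<epsilon>\<rfloor> - x $ i / \<epsilon>)"
      using assms by (simp add: lattice_point_def floor_vec_def divide_inverse algebra_simps)
    moreover have "\<bar>real_of_int \<lfloor>x $ i / \<epsilon>\<rfloor> - x $ i / \<epsilon>\<bar> \<le> 1"
      by linarith
    ultimately show ?thesis
      using assms by (simp add: abs_mult mult_left_le)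
  qed
  then have "(\<Sum>i\<in>UNIV. \<bar>(lattice_point \<epsilon> (floor_vec (x /\<^sub>R \<epsilon>)) - x) $ i\<bar>) \<le> (\<Sum>i\<in>(UNIV :: 'd set). \<epsilon>)"
    by (intro sum_mono)
  then show ?thesis
    using norm_le_l1_cart[of "lattice_point \<epsilon> (floor_vec (x /\<^sub>R \<epsilon>)) - x"] by simp
qed

section \<open>The corrected ansatz and its residual\<close>

context environment
begin

definition walk_mean :: "'a \<Rightarrow> (int ^ 'd \<Rightarrow> real) \<Rightarrow> int ^ 'd \<Rightarrow> real" where
  "walk_mean \<omega> H z = nbr_mean k (b (\<tau> z \<omega>)) (\<lambda>i s. H (z + axis i s))"

lemma sup_contraction_walk_mean: "\<omega> \<in> \<Omega> \<Longrightarrow> sup_contraction (walk_mean \<omega>)"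
  by unfold_locales
    (auto simp: walk_mean_def nbr_mean_diff intro!: nbr_mean_abs_le less_imp_le[OF b_less] closed)

text \<open>\<open>H\<close> is a bounded lattice solution along one orbit. \<open>C\<close> depends
  neither on \<omega> nor on \<open>H\<close> nor on the site, which makes the convergence uniform.
  The residual of order \<epsilon>^3 meets the maximum principle with \<kappa> =
  \<epsilon>^2.\<close>

lemma two_scale_expansion:
  assumes \<phi>: "\<And>\<omega>. \<omega> \<in> \<Omega> \<Longrightarrow> env_gen \<phi> \<omega> = - 2 * b \<omega>"
    and \<psi>: "\<And>j \<omega>. \<omega> \<in> \<Omega> \<Longrightarrow>
      env_gen (\<psi> j) \<omega> = - flux \<phi> j \<omega> + (if j = k then q - 1 / (2 * real CARD('d)) else 0)"
    and u: "bounded_Ck 3 u"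
    and eq: "\<And>x. - q * partial_deriv k (partial_deriv k u) x
          - (\<Sum>j\<in>UNIV - {k}. 1 / (2 * real CARD('d)) * partial_deriv j (partial_deriv j u) x)
          + u x = f x"
  shows "\<exists>C. \<forall>\<epsilon> \<omega> H z. 0 < \<epsilon> \<longrightarrow> \<epsilon> \<le> 1 \<longrightarrow> \<omega> \<in> \<Omega> \<longrightarrow> bounded (range H) \<longrightarrow>
    (\<forall>z. (1 + \<epsilon>\<^sup>2) * H z = walk_mean \<omega> H z + \<epsilon>\<^sup>2 * f (lattice_point \<epsilon> z)) \<longrightarrow>
    \<bar>H z - u (lattice_point \<epsilon> z)\<bar> \<le> C * \<epsilon>"
proof -
  define u1 where "u1 = partial_deriv k u"
  define u2 where "u2 j = partial_deriv j u1" for j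
  have Ck_u1: "bounded_Ck 2 u1" and Ck_u2: "bounded_Ck 1 (u2 j)" for j
    using u by (simp_all add: u1_def u2_def eval_nat_numeral)
  have bdd: "\<exists>B. \<forall>\<omega>\<in>\<Omega>. \<bar>g \<omega>\<bar> \<le> B" for g :: "'a \<Rightarrow> real"
    by (rule exI[of _ "Max ((\<lambda>\<omega>. \<bar>g \<omega>\<bar>) ` \<Omega>)"]) (auto intro!: Max_ge simp: finite_space)
  obtain B where B: "\<And>\<omega>. \<omega> \<in> \<Omega> \<Longrightarrow> \<bar>\<phi> \<omega>\<bar> \<le> B"
    using bdd[of \<phi>] by blast
  obtain BB where BB: "\<And>j \<omega>. \<omega> \<in> \<Omega> \<Longrightarrow> \<bar>\<psi> j \<omega>\<bar> \<le> BB j"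
    using bdd[of "\<psi> j" for j] by metis
  have bdd_Ck: "\<exists>U. \<forall>x. \<bar>g x\<bar> \<le> U" if "bounded_Ck n g" for n and g :: "real ^ 'd \<Rightarrow> real"
    using bounded_Ck_bounded[OF that] by (auto simp: bounded_iff)
  obtain U1 where U1: "\<And>x. \<bar>u1 x\<bar> \<le> U1"
    using bdd_Ck[OF Ck_u1] by blast
  obtain U2 where U2: "\<And>j x. \<bar>u2 j x\<bar> \<le> U2 j"
    using bdd_Ck[OF Ck_u2] by metis
  obtain K3 where K3: "\<And>x s i. \<bar>u (x + s *\<^sub>R axis i 1) -
      (\<Sum>m<3. (partial_deriv i ^^ m) u x / fact m * s ^ m)\<bar> \<le> K3 * \<bar>s\<bar> ^ 3"
    using taylor_uniform[OF u] by blast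
  obtain K2 where K2: "\<And>x s i. \<bar>u1 (x + s *\<^sub>R axis i 1) -
      (\<Sum>m<2. (partial_deriv i ^^ m) u1 x / fact m * s ^ m)\<bar> \<le> K2 * \<bar>s\<bar>\<^sup>2"
    using taylor_uniform[OF Ck_u1] by blast
  have "\<forall>j. \<exists>K. \<forall>x s i. \<bar>u2 j (x + s *\<^sub>R axis i 1) -
      (\<Sum>m<1. (partial_deriv i ^^ m) (u2 j) x / fact m * s ^ m)\<bar> \<le> K * \<bar>s\<bar> ^ 1"
    by (rule allI) (rule taylor_uniform[OF Ck_u2])
  then obtain K1 where "\<forall>j x s i. \<bar>u2 j (x + s *\<^sub>R axis i 1) -
      (\<Sum>m<1. (partial_deriv i ^^ m) (u2 j) x / fact m * s ^ m)\<bar> \<le> K1 j * \<bar>s\<bar> ^ 1"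
    unfolding choice_iff by blast
  then have K1: "\<bar>u2 j (x + s *\<^sub>R axis i 1) -
      (\<Sum>m<1. (partial_deriv i ^^ m) (u2 j) x / fact m * s ^ m)\<bar> \<le> K1 j * \<bar>s\<bar> ^ 1"
    for j x s i by blast
  define C1 where "C1 = B * U1 + (\<Sum>j\<in>UNIV. BB j * U2 j)"
  define C2 where "C2 = K3 + B * K2 + (\<Sum>j\<in>UNIV. BB j * K1 j)"
  show ?thesis
  proof (intro exI allI impI)
    fix \<epsilon> \<omega> H z
    assume \<epsilon>: "0 < \<epsilon>" "\<epsilon> \<le> 1" and \<omega>: "\<omega> \<in> \<Omega>" and H: "bounded (range H)"
      and H_eq: "\<forall>z. (1 + \<epsilon>\<^sup>2) * H z = walk_mean \<omega> H z + \<epsilon>\<^sup>2 * f (lattice_point \<epsilon> z)"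
    interpret walk: sup_contraction "walk_mean \<omega>"
      by (rule sup_contraction_walk_mean[OF \<omega>])
    define W where "W z = u (lattice_point \<epsilon> z) + \<epsilon> * (\<phi> (\<tau> z \<omega>) * u1 (lattice_point \<epsilon> z)) +
      \<epsilon>\<^sup>2 * (\<Sum>j\<in>UNIV. \<psi> j (\<tau> z \<omega>) * u2 j (lattice_point \<epsilon> z))" for z
    have W_near: "\<bar>W z - u (lattice_point \<epsilon> z)\<bar> \<le> C1 * \<epsilon>" for z
    proof -
      let ?x = "lattice_point \<epsilon> z" and ?\<omega> = "\<tau> z \<omega>"
      have "\<bar>\<phi> ?\<omega> * u1 ?x\<bar> \<le> B * U1"
        unfolding abs_mult using B[OF closed[OF \<omega>], of z] U1[of ?x] by (intro mult_mono) auto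
      then have 1: "\<bar>\<epsilon> * (\<phi> ?\<omega> * u1 ?x)\<bar> \<le> \<epsilon> * (B * U1)"
        using \<epsilon> by (simp only: abs_mult[of \<epsilon>] abs_of_pos mult_left_mono less_imp_le)
      have 2: "\<bar>\<Sum>j\<in>UNIV. \<psi> j ?\<omega> * u2 j ?x\<bar> \<le> (\<Sum>j\<in>UNIV. BB j * U2 j)"
      proof (rule order_trans[OF sum_abs sum_mono])
        show "\<bar>\<psi> j ?\<omega> * u2 j ?x\<bar> \<le> BB j * U2 j" for j
          unfolding abs_mult using BB[OF closed[OF \<omega>], of j z] U2[of j ?x] by (intro mult_mono) auto
      qed
      have "\<bar>\<epsilon>\<^sup>2 * (\<Sum>j\<in>UNIV. \<psi> j ?\<omega> * u2 j ?x)\<bar> \<le> \<epsilon> * (\<Sum>j\<in>UNIV. BB j * U2 j)"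
        unfolding abs_mult using \<epsilon> 2
        by (intro mult_mono) (auto simp: power2_eq_square mult_left_le)
      with 1 show ?thesis
        unfolding W_def C1_def distrib_right by (simp add: mult.commute)
    qed
    \<comment> \<open>At order \<epsilon> the drift term 2 b \<open>u1\<close> cancels against the
      generator of \<phi>; at order \<epsilon>^2 the flux sum F produced by \<phi> cancels against
      -F produced by the \<psi> j.\<close>
    have residual: "\<bar>(1 + \<epsilon>\<^sup>2) * W z - walk_mean \<omega> W z - \<epsilon>\<^sup>2 * f (lattice_point \<epsilon> z)\<bar> \<le> (C1 + C2) * \<epsilon> ^ 3" for z
    proof -
      let ?x = "lattice_point \<epsilon> z" and ?\<omega> = "\<tau> z \<omega>"
      have \<omega>z: "?\<omega> \<in> \<Omega>"
        using closed[OF \<omega>] .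
      let ?\<beta> = "b ?\<omega>"
      have \<beta>: "\<bar>?\<beta>\<bar> \<le> 1 / (2 * real CARD('d))"
        using b_less[OF \<omega>z] by simp
      define X where "X = (\<lambda>i (s::int). \<phi> (\<tau> (axis i s) ?\<omega>))"
      define Y where "Y = (\<lambda>j i (s::int). \<psi> j (\<tau> (axis i s) ?\<omega>))"
      have shift: "\<tau> (z + axis i s) \<omega> = \<tau> (axis i s) ?\<omega>" for i s
        using compose[OF \<omega>] by (simp add: add.commute)
      define Mu where "Mu = nbr_mean k ?\<beta> (\<lambda>i s. u (?x + (\<epsilon> * of_int s) *\<^sub>R axis i 1))"
      define MX where "MX = nbr_mean k ?\<beta> (\<lambda>i s. X i s * u1 (?x + (\<epsilon> * of_int s) *\<^sub>R axis i 1))"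
      define MY where "MY j = nbr_mean k ?\<beta> (\<lambda>i s. Y j i s * u2 j (?x + (\<epsilon> * of_int s) *\<^sub>R axis i 1))" for j
      have mean_W: "walk_mean \<omega> W z = Mu + \<epsilon> * MX + \<epsilon>\<^sup>2 * (\<Sum>j\<in>UNIV. MY j)"
        unfolding walk_mean_def W_def lattice_point_add_axis shift Mu_def MX_def MY_def X_def Y_def
        by (simp only: nbr_mean_add nbr_mean_cmult nbr_mean_sum)
      have mean_X: "nbr_mean k ?\<beta> X = \<phi> ?\<omega> - 2 * ?\<beta>"
        using \<phi>[OF \<omega>z] by (simp add: env_gen_def X_def)
      have mean_Y: "nbr_mean k ?\<beta> (Y j) =
          \<psi> j ?\<omega> - flux \<phi> j ?\<omega> + (if j = k then q - 1 / (2 * real CARD('d)) else 0)" for j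
        using \<psi>[OF \<omega>z, of j] by (simp add: env_gen_def Y_def)
      have flux: "nbr_mean k ?\<beta> (\<lambda>i s. if i = j then of_int s * X i s else 0) = flux \<phi> j ?\<omega>" for j
        unfolding flux_def X_def ..
      define S where "S = (\<Sum>i\<in>UNIV. 1 / (2 * real CARD('d)) * partial_deriv i (partial_deriv i u) ?x)"
      define F where "F = (\<Sum>j\<in>UNIV. u2 j ?x * flux \<phi> j ?\<omega>)"
      have EU: "\<bar>Mu - (u ?x + \<epsilon> * (2 * ?\<beta> * u1 ?x) + \<epsilon>\<^sup>2 * S)\<bar> \<le> K3 * \<epsilon> ^ 3"
        unfolding Mu_def S_def u1_def using nbr_mean_expansion3[OF K3 less_imp_le[OF \<epsilon>(1)] \<beta>] .
      have "\<bar>MX - (u1 ?x * nbr_mean k ?\<beta> X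
          + \<epsilon> * (\<Sum>j\<in>UNIV. u2 j ?x * nbr_mean k ?\<beta> (\<lambda>i s. if i = j then of_int s * X i s else 0)))\<bar>
          \<le> B * K2 * \<epsilon>\<^sup>2"
        unfolding MX_def u2_def by (rule nbr_mean_expansion2[OF K2 \<beta>]) (simp add: X_def B closed \<omega>z)
      then have EX: "\<bar>MX - (u1 ?x * (\<phi> ?\<omega> - 2 * ?\<beta>) + \<epsilon> * F)\<bar> \<le> B * K2 * \<epsilon>\<^sup>2"
        unfolding mean_X flux F_def .
      have "\<bar>\<epsilon> * (MX - (u1 ?x * (\<phi> ?\<omega> - 2 * ?\<beta>) + \<epsilon> * F))\<bar> \<le> \<epsilon> * (B * K2 * \<epsilon>\<^sup>2)"
        unfolding abs_mult abs_of_pos[OF \<epsilon>(1)] by (rule mult_left_mono[OF EX less_imp_le[OF \<epsilon>(1)]])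
      then have EX': "\<bar>\<epsilon> * MX - (\<epsilon> * (u1 ?x * (\<phi> ?\<omega> - 2 * ?\<beta>)) + \<epsilon>\<^sup>2 * F)\<bar> \<le> B * K2 * \<epsilon> ^ 3"
        by (simp add: power2_eq_square power3_eq_cube algebra_simps)
      have "\<bar>(\<Sum>j\<in>UNIV. MY j) - (\<Sum>j\<in>UNIV. u2 j ?x * nbr_mean k ?\<beta> (Y j))\<bar> \<le> (\<Sum>j\<in>UNIV. BB j * K1 j * \<epsilon>)"
        unfolding sum_subtractf[symmetric]
      proof (rule order_trans[OF sum_abs sum_mono])
        show "\<bar>MY j - u2 j ?x * nbr_mean k ?\<beta> (Y j)\<bar> \<le> BB j * K1 j * \<epsilon>" for j
          unfolding MY_def by (rule nbr_mean_expansion1[OF K1 less_imp_le[OF \<epsilon>(1)] \<beta>]) (simp add: Y_def BB closed \<omega>z)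
      qed
      also have "(\<Sum>j\<in>UNIV. u2 j ?x * nbr_mean k ?\<beta> (Y j)) =
          (\<Sum>j\<in>UNIV. \<psi> j ?\<omega> * u2 j ?x - u2 j ?x * flux \<phi> j ?\<omega>
            + (if j = k then u2 j ?x * (q - 1 / (2 * real CARD('d))) else 0))"
        unfolding mean_Y by (intro sum.cong) (auto simp: algebra_simps)
      also have "\<dots> = (\<Sum>j\<in>UNIV. \<psi> j ?\<omega> * u2 j ?x) - F + u2 k ?x * (q - 1 / (2 * real CARD('d)))"
        unfolding F_def by (simp only: sum.distrib sum_subtractf sum.delta finite UNIV_I if_True)
      also have "(\<Sum>j\<in>UNIV. BB j * K1 j * \<epsilon>) = (\<Sum>j\<in>UNIV. BB j * K1 j) * \<epsilon>"
        by (simp only: sum_distrib_right)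
      finally have EY: "\<bar>(\<Sum>j\<in>UNIV. MY j) -
          ((\<Sum>j\<in>UNIV. \<psi> j ?\<omega> * u2 j ?x) - F + u2 k ?x * (q - 1 / (2 * real CARD('d))))\<bar>
          \<le> (\<Sum>j\<in>UNIV. BB j * K1 j) * \<epsilon>" .
      define P where "P = (\<Sum>j\<in>UNIV. \<psi> j ?\<omega> * u2 j ?x)"
      define c where "c = u2 k ?x * (q - 1 / (2 * real CARD('d)))"
      have "\<bar>\<epsilon>\<^sup>2 * ((\<Sum>j\<in>UNIV. MY j) - (P - F + c))\<bar> \<le> \<epsilon>\<^sup>2 * ((\<Sum>j\<in>UNIV. BB j * K1 j) * \<epsilon>)"
        using mult_left_mono[OF EY, of "\<epsilon>\<^sup>2"] by (simp add: abs_mult P_def c_def)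
      then have EY': "\<bar>\<epsilon>\<^sup>2 * (\<Sum>j\<in>UNIV. MY j) - (\<epsilon>\<^sup>2 * P - \<epsilon>\<^sup>2 * F + \<epsilon>\<^sup>2 * c)\<bar> \<le> (\<Sum>j\<in>UNIV. BB j * K1 j) * \<epsilon> ^ 3"
        by (simp add: power2_eq_square power3_eq_cube right_diff_distrib distrib_left mult_ac)
      \<comment> \<open>\<open>c\<close> exchanges the coefficient 1/(2d) of the second derivative
        along \<open>k\<close> for q, so S + c is the homogenized second-order operator applied to
        u.\<close>
      have S: "S + c = u ?x - f ?x"
      proof -
        have "S = 1 / (2 * real CARD('d)) * u2 k ?x +
            (\<Sum>j\<in>UNIV - {k}. 1 / (2 * real CARD('d)) * partial_deriv j (partial_deriv j u) ?x)"
          unfolding S_def u2_def u1_def by (rule sum.remove) auto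
        moreover have "q * u2 k ?x = 1 / (2 * real CARD('d)) * u2 k ?x + c"
          by (simp add: c_def algebra_simps)
        ultimately show ?thesis
          using eq[of ?x] unfolding u2_def u1_def by linarith
      qed
      have eq2: "\<epsilon>\<^sup>2 * S + \<epsilon>\<^sup>2 * c = \<epsilon>\<^sup>2 * u ?x - \<epsilon>\<^sup>2 * f ?x"
        unfolding distrib_left[symmetric] right_diff_distrib[symmetric] S ..
      have eq1: "\<epsilon> * (u1 ?x * (\<phi> ?\<omega> - 2 * ?\<beta>)) = \<epsilon> * (\<phi> ?\<omega> * u1 ?x) - \<epsilon> * (2 * ?\<beta> * u1 ?x)"
        by (simp add: algebra_simps)
      have W: "W z = u ?x + \<epsilon> * (\<phi> ?\<omega> * u1 ?x) + \<epsilon>\<^sup>2 * P"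
        by (simp add: W_def P_def)
      \<comment> \<open>The zero-order term of the lattice equation contains W rather than u; the
        difference costs C1 \<epsilon>^3.\<close>
      have "\<bar>\<epsilon>\<^sup>2 * (W z - u ?x)\<bar> \<le> \<epsilon>\<^sup>2 * (C1 * \<epsilon>)"
        unfolding abs_mult using W_near[of z] by (simp add: mult_left_mono)
      then have "\<bar>\<epsilon>\<^sup>2 * W z - \<epsilon>\<^sup>2 * u ?x\<bar> \<le> C1 * \<epsilon> ^ 3"
        by (simp add: power2_eq_square power3_eq_cube right_diff_distrib mult_ac)
      then show ?thesis
        using EU EX' EY' eq1 eq2 W unfolding mean_W C2_def distrib_right by linarith
    qed
    have "\<exists>D. \<forall>z. \<bar>W z\<bar> \<le> D"
    proof -
      obtain U where U: "\<And>x. \<bar>u x\<bar> \<le> U"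
        using bounded_Ck_bounded[OF u] by (auto simp: bounded_iff)
      have "\<bar>W z\<bar> \<le> C1 * \<epsilon> + U" for z
        using W_near[of z] U[of "lattice_point \<epsilon> z"] by linarith
      then show ?thesis by blast
    qed
    then have "bounded (range W)"
      by (auto simp: bounded_iff)
    then have "bounded (range (\<lambda>z. H z - W z))"
      by (rule bounded_minus_comp[OF H])
    moreover have "\<bar>(1 + \<epsilon>\<^sup>2) * (H z - W z) - walk_mean \<omega> (\<lambda>z. H z - W z) z\<bar> \<le> (C1 + C2) * \<epsilon> ^ 3" for z
      unfolding walk.diff right_diff_distrib using residual[of z] H_eq[rule_format, of z] by linarith
    ultimately have "\<bar>H z - W z\<bar> \<le> (C1 + C2) * \<epsilon> ^ 3 / \<epsilon>\<^sup>2"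
      using \<epsilon> by (intro walk.max_principle) auto
    also have "\<dots> = (C1 + C2) * \<epsilon>"
      using \<epsilon> by (simp add: power2_eq_square power3_eq_cube)
    finally show "\<bar>H z - u (lattice_point \<epsilon> z)\<bar> \<le> (C1 + C2 + C1) * \<epsilon>"
      using W_near[of z] unfolding distrib_right by linarith
  qed
qed

end

section \<open>Well-posedness on the lattice and conclusion\<close>

lemma (in environment) lattice_solution_iff:
  assumes "space M = \<Omega>"
  shows "lattice_solution M \<tau> k b f \<epsilon> v \<longleftrightarrow>
    (\<forall>z. \<forall>\<omega>\<in>\<Omega>. (1 + \<epsilon>\<^sup>2) * v (lattice_point \<epsilon> z) \<omega> =
      walk_mean \<omega> (\<lambda>z. v (lattice_point \<epsilon> z) \<omega>) z + \<epsilon>\<^sup>2 * f (lattice_point \<epsilon> z))"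
proof -
  have "lattice_point \<epsilon> z + (\<epsilon> * real_of_int 1) *\<^sub>R axis i 1 = lattice_point \<epsilon> z + \<epsilon> *\<^sub>R axis i 1"
    "lattice_point \<epsilon> z + (\<epsilon> * real_of_int (- 1)) *\<^sub>R axis i 1 = lattice_point \<epsilon> z - \<epsilon> *\<^sub>R axis i 1"
    for z and i :: 'd
    by simp_all
  then have mean: "walk_mean \<omega> (\<lambda>z. v (lattice_point \<epsilon> z) \<omega>) z =
      (\<Sum>i\<in>UNIV. 1 / (2 * real CARD('d)) *
        (v (lattice_point \<epsilon> z + \<epsilon> *\<^sub>R axis i 1) \<omega> + v (lattice_point \<epsilon> z - \<epsilon> *\<^sub>R axis i 1) \<omega>))
      + b (\<tau> z \<omega>) * (v (lattice_point \<epsilon> z + \<epsilon> *\<^sub>R axis k 1) \<omega> - v (lattice_point \<epsilon> z - \<epsilon> *\<^sub>R axis k 1) \<omega>)"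
    for z \<omega>
    unfolding walk_mean_def nbr_mean_def lattice_point_add_axis by (simp only:)
  have rearrange: "A - S - T + e * A = r \<longleftrightarrow> (1 + e) * A = S + T + r" for A S T e r :: real
    unfolding distrib_right mult_1 by linarith
  show ?thesis
    unfolding lattice_solution_def Let_def assms mean rearrange ..
qed

lemma homogenized_equation_iff:
  fixes k :: "'d::finite" and u :: "real ^ 'd \<Rightarrow> real"
  shows "- q * partial_deriv k (partial_deriv k u) x
        - (\<Sum>j\<in>UNIV - {k}. 1 / (2 * real CARD('d)) * partial_deriv j (partial_deriv j u) x) + u x = f x \<longleftrightarrow>
    u x - (\<Sum>i\<in>UNIV. (if i = k then q else 1 / (2 * real CARD('d))) * partial_deriv i (partial_deriv i u) x) = f x"
proof -
  define D where "D x i = partial_deriv i (partial_deriv i u) x" for x i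
  have "(\<Sum>i\<in>UNIV. (if i = k then q else 1 / (2 * real CARD('d))) * D x i) =
      q * D x k + (\<Sum>j\<in>UNIV - {k}. (if j = k then q else 1 / (2 * real CARD('d))) * D x j)"
    by (subst sum.remove[of UNIV k]) auto
  also have "(\<Sum>j\<in>UNIV - {k}. (if j = k then q else 1 / (2 * real CARD('d))) * D x j) =
      (\<Sum>j\<in>UNIV - {k}. 1 / (2 * real CARD('d)) * D x j)"
    by (intro sum.cong) auto
  finally show ?thesis
    unfolding D_def by linarith
qed

lemma (in environment) lattice_solution_unique:
  assumes "space M = \<Omega>" and f: "bounded (range f)" and "\<epsilon> > 0"
  shows "\<exists>v. bounded_lattice_solution M \<tau> k b f \<epsilon> v \<and>
       (\<forall>w. bounded_lattice_solution M \<tau> k b f \<epsilon> w \<longrightarrow>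
          (\<forall>x\<in>range (lattice_point \<epsilon>). \<forall>\<omega>\<in>space M. w x \<omega> = v x \<omega>))"
proof -
  note iff = lattice_solution_iff[OF assms(1)]
  have \<epsilon>2: "\<epsilon>\<^sup>2 > 0"
    using \<open>\<epsilon> > 0\<close> by simp
  obtain K where K: "\<And>x. \<bar>f x\<bar> \<le> K"
    using f by (auto simp: bounded_iff)
  then have bdd_f: "bounded (range (\<lambda>z. f (lattice_point \<epsilon> z)))"
    by (auto simp: bounded_iff)
  have "\<exists>H. bounded (range H) \<and> (\<forall>z. (1 + \<epsilon>\<^sup>2) * H z = walk_mean \<omega> H z + \<epsilon>\<^sup>2 * f (lattice_point \<epsilon> z))"
    if "\<omega> \<in> \<Omega>" for \<omega>
    using sup_contraction.bounded_solution_exists[OF sup_contraction_walk_mean[OF that] \<epsilon>2 bdd_f] by metis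
  then obtain H where H: "\<And>\<omega>. \<omega> \<in> \<Omega> \<Longrightarrow> bounded (range (H \<omega>))"
    "\<And>\<omega> z. \<omega> \<in> \<Omega> \<Longrightarrow> (1 + \<epsilon>\<^sup>2) * H \<omega> z = walk_mean \<omega> (H \<omega>) z + \<epsilon>\<^sup>2 * f (lattice_point \<epsilon> z)"
    by metis
  \<comment> \<open>Injectivity of \<open>lattice_point \<epsilon>\<close> makes this well defined
    on the scaled lattice; elsewhere the values are arbitrary.\<close>
  define v where "v x \<omega> = H \<omega> (inv (lattice_point \<epsilon>) x)" for x \<omega>
  have v: "v (lattice_point \<epsilon> z) \<omega> = H \<omega> z" for z \<omega>
    using \<open>\<epsilon> > 0\<close> by (simp add: v_def inv_f_f inj_lattice_point)
  \<comment> \<open>The bounds supplied with the individual \<open>H \<omega>\<close> may depend on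
    \<omega>; the maximum principle replaces them by a common one.\<close>
  have HK: "\<bar>H \<omega> z\<bar> \<le> \<epsilon>\<^sup>2 * K / \<epsilon>\<^sup>2" if "\<omega> \<in> \<Omega>" for \<omega> z
  proof (rule sup_contraction.max_principle[OF sup_contraction_walk_mean[OF that] \<epsilon>2 H(1)[OF that]])
    show "\<bar>(1 + \<epsilon>\<^sup>2) * H \<omega> z - walk_mean \<omega> (H \<omega>) z\<bar> \<le> \<epsilon>\<^sup>2 * K" for z
      using H(2)[OF that, of z] K[of "lattice_point \<epsilon> z"] by (simp add: abs_mult mult_left_mono)
  qed
  have "bounded {v x \<omega> | x \<omega>. x \<in> range (lattice_point \<epsilon>) \<and> \<omega> \<in> space M}"
    unfolding bounded_iff
  proof (intro exI ballI)
    fix y assume "y \<in> {v x \<omega> | x \<omega>. x \<in> range (lattice_point \<epsilon>) \<and> \<omega> \<in> space M}"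
    then obtain z \<omega> where "y = H \<omega> z" "\<omega> \<in> \<Omega>"
      using v assms(1) by auto
    then show "norm y \<le> \<epsilon>\<^sup>2 * K / \<epsilon>\<^sup>2"
      using HK by (simp only: real_norm_def)
  qed
  then have sol: "bounded_lattice_solution M \<tau> k b f \<epsilon> v"
    unfolding bounded_lattice_solution_def iff using H(2) by (simp add: v)
  moreover have "w x \<omega> = v x \<omega>"
    if w: "bounded_lattice_solution M \<tau> k b f \<epsilon> w" and x: "x \<in> range (lattice_point \<epsilon>)" and "\<omega> \<in> space M"
    for w x \<omega>
  proof -
    have \<omega>: "\<omega> \<in> \<Omega>"
      using that(3) assms(1) by simp
    interpret walk: sup_contraction "walk_mean \<omega>"
      by (rule sup_contraction_walk_mean[OF \<omega>])
    obtain z where z: "x = lattice_point \<epsilon> z"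
      using x by auto
    let ?d = "\<lambda>z. w (lattice_point \<epsilon> z) \<omega> - H \<omega> z"
    have "bounded (range (\<lambda>z. w (lattice_point \<epsilon> z) \<omega>))"
      by (rule bounded_subset[of "{w x \<omega> | x \<omega>. x \<in> range (lattice_point \<epsilon>) \<and> \<omega> \<in> space M}"])
        (use w that(3) in \<open>auto simp: bounded_lattice_solution_def\<close>)
    then have "bounded (range ?d)"
      using H(1)[OF \<omega>] by (rule bounded_minus_comp)
    moreover have "\<bar>(1 + \<epsilon>\<^sup>2) * ?d z - walk_mean \<omega> ?d z\<bar> \<le> 0" for z
      using w H(2)[OF \<omega>, of z] \<omega> unfolding bounded_lattice_solution_def iff walk.diff right_diff_distrib
      by simp
    ultimately have "\<bar>?d z\<bar> \<le> 0 / \<epsilon>\<^sup>2"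
      by (rule walk.max_principle[OF \<epsilon>2])
    then show ?thesis
      by (simp add: z v)
  qed
  ultimately show ?thesis by blast
qed

text \<open>\<open>q\<close> is chosen before f. Convergence is claimed for any choice of bounded
  solutions, and the two well-posedness claims ensure that such solutions exist and are unique, on
  the lattice side as far as the equation sees them.\<close>

theorem theorem1p1:
  fixes M :: "'a measure" and \<tau> :: "int ^ 'd \<Rightarrow> 'a \<Rightarrow> 'a" and k :: 'd and b :: "'a \<Rightarrow> real"
  assumes "prob_space M" and "finite (space M)" and "sets M = Pow (space M)"
    and "measure_preserving_action M \<tau>"
    and "ergodic_action M \<tau>"
    and "(SUP \<omega>\<in>space M. \<bar>b \<omega>\<bar>) < 1 / (2 * real CARD('d))"
    and "reflection_invariant M \<tau> k b"
  shows "\<exists>q>0. \<forall>f :: real ^ 'd \<Rightarrow> real. smooth f \<and> compactly_supported f \<longrightarrow>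
    (\<forall>\<epsilon>>0. \<exists>v. bounded_lattice_solution M \<tau> k b f \<epsilon> v \<and>
       (\<forall>w. bounded_lattice_solution M \<tau> k b f \<epsilon> w \<longrightarrow>
          (\<forall>x\<in>range (lattice_point \<epsilon>). \<forall>\<omega>\<in>space M. w x \<omega> = v x \<omega>))) \<and>
    (\<exists>!u. bounded_homogenized_solution k q f u) \<and>
    (\<forall>u\<epsilon> u. (\<forall>\<epsilon>>0. bounded_lattice_solution M \<tau> k b f \<epsilon> (u\<epsilon> \<epsilon>)) \<and>
        bounded_homogenized_solution k q f u \<longrightarrow>
       ((\<lambda>\<epsilon>. SUP (x, \<omega>)\<in>UNIV \<times> space M.
            \<bar>u\<epsilon> \<epsilon> (lattice_point \<epsilon> (floor_vec (x /\<^sub>R \<epsilon>))) \<omega> - u x\<bar>) \<longlongrightarrow> 0) (at_right 0))"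
proof -
  interpret environment "space M" \<tau> k b
    by (rule environment_of_action) fact+
  obtain \<omega>0 \<omega>1 where \<omega>01: "\<omega>0 \<in> space M" "\<omega>1 \<in> space M"
    "\<And>x. b (\<tau> (reflect k x) \<omega>1) = - b (\<tau> x \<omega>0)"
    using reflected_pair_exists[OF assms(1,2,3,7)] by blast
  interpret reflected_environment "space M" \<tau> k b \<omega>0 \<omega>1
    by unfold_locales (rule \<omega>01)+
  obtain q \<phi> \<psi> where q: "q > 0"
    and \<phi>: "\<forall>\<omega>\<in>space M. env_gen \<phi> \<omega> = - 2 * b \<omega>"
    and \<psi>: "\<forall>j. \<forall>\<omega>\<in>space M. env_gen (\<psi> j) \<omega> =
      - flux \<phi> j \<omega> + (if j = k then q - 1 / (2 * real CARD('d)) else 0)"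
    using correctors by blast
  \<comment> \<open>Diagonal coefficients of the homogenized operator; q > 0 makes them an instance
    of \<open>elliptic\<close>.\<close>
  define a where "a i = (if i = k then q else 1 / (2 * real CARD('d)))" for i :: 'd
  interpret elliptic a
    by unfold_locales (use q in \<open>auto simp: a_def\<close>)
  have hom_iff: "bounded_homogenized_solution k q f u \<longleftrightarrow> Ck 2 u \<and> bounded (range u) \<and>
      (\<forall>x. u x - (\<Sum>i\<in>UNIV. a i * partial_deriv i (partial_deriv i u) x) = f x)" for f u
    unfolding bounded_homogenized_solution_def homogenized_equation_iff a_def ..
  show ?thesis
  proof (intro exI[of _ q] conjI q allI impI)
    fix f :: "real ^ 'd \<Rightarrow> real" and \<epsilon> :: real
    assume "smooth f \<and> compactly_supported f" "\<epsilon> > 0"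
    then show "\<exists>v. bounded_lattice_solution M \<tau> k b f \<epsilon> v \<and>
       (\<forall>w. bounded_lattice_solution M \<tau> k b f \<epsilon> w \<longrightarrow>
          (\<forall>x\<in>range (lattice_point \<epsilon>). \<forall>\<omega>\<in>space M. w x \<omega> = v x \<omega>))"
      using bounded_Ck_bounded[OF compactly_supported_bounded_Ck, of f 0]
      by (intro lattice_solution_unique) (auto simp: smooth_def)
  next
    fix f :: "real ^ 'd \<Rightarrow> real"
    assume f: "smooth f \<and> compactly_supported f"
    then have Ck_f: "bounded_Ck n f" for n
      by (intro compactly_supported_bounded_Ck) (auto simp: smooth_def)
    define v where "v = resolvent f"
    have Ck_v: "bounded_Ck n v" for n
      unfolding v_def by (rule bounded_Ck_resolvent) (rule Ck_f)
    have v: "bounded_homogenized_solution k q f v"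
      unfolding hom_iff
      using bounded_Ck_imp_Ck[OF Ck_v] bounded_Ck_bounded[OF Ck_v] resolvent_equation[OF Ck_f]
      by (auto simp: v_def)
    have unique: "u = v" if u: "bounded_homogenized_solution k q f u" for u
    proof
      fix x
      have "\<bar>u x - v x\<bar> \<le> 0"
        by (rule elliptic_max_principle_abs[of _ _ a])
          (use u v a_pos in \<open>auto simp: hom_iff intro: less_imp_le\<close>)
      then show "u x = v x" by simp
    qed
    show "\<exists>!u. bounded_homogenized_solution k q f u"
      using v unique by blast
    fix u\<epsilon> :: "real \<Rightarrow> real ^ 'd \<Rightarrow> 'a \<Rightarrow> real" and u
    assume asm: "(\<forall>\<epsilon>>0. bounded_lattice_solution M \<tau> k b f \<epsilon> (u\<epsilon> \<epsilon>)) \<and> bounded_homogenized_solution k q f u"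
    have u: "u = v"
      using asm unique by blast
    have "\<exists>C. \<forall>\<epsilon> \<omega> H z. 0 < \<epsilon> \<longrightarrow> \<epsilon> \<le> 1 \<longrightarrow> \<omega> \<in> space M \<longrightarrow> bounded (range H) \<longrightarrow>
        (\<forall>z. (1 + \<epsilon>\<^sup>2) * H z = walk_mean \<omega> H z + \<epsilon>\<^sup>2 * f (lattice_point \<epsilon> z)) \<longrightarrow>
        \<bar>H z - u (lattice_point \<epsilon> z)\<bar> \<le> C * \<epsilon>"
    proof (rule two_scale_expansion[of \<phi> \<psi> q u f])
      show "bounded_Ck 3 u"
        unfolding u by (rule Ck_v)
    qed (use \<phi> \<psi> asm in \<open>auto simp only: bounded_homogenized_solution_def\<close>)
    then obtain C where C: "\<forall>\<epsilon> \<omega> H z. 0 < \<epsilon> \<longrightarrow> \<epsilon> \<le> 1 \<longrightarrow> \<omega> \<in> space M \<longrightarrow> bounded (range H) \<longrightarrow>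
        (\<forall>z. (1 + \<epsilon>\<^sup>2) * H z = walk_mean \<omega> H z + \<epsilon>\<^sup>2 * f (lattice_point \<epsilon> z)) \<longrightarrow>
        \<bar>H z - u (lattice_point \<epsilon> z)\<bar> \<le> C * \<epsilon>"
      by blast
    obtain L where L: "\<And>x y. \<bar>u x - u y\<bar> \<le> L * norm (x - y)"
      using lipschitz_of_bounded_Ck[OF Ck_v] u by metis
    have "0 \<le> L"
      using L[of "axis k 1" 0] by simp
    \<comment> \<open>\<open>C\<close> accounts for the expansion error at lattice points, L times d
      for moving x to its lattice point.\<close>
    define D where "D = C + L * real CARD('d)"
    have bound: "\<bar>u\<epsilon> \<epsilon> (lattice_point \<epsilon> (floor_vec (x /\<^sub>R \<epsilon>))) \<omega> - u x\<bar> \<le> D * \<epsilon>"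
      if \<epsilon>: "0 < \<epsilon>" "\<epsilon> \<le> 1" and \<omega>: "\<omega> \<in> space M" for \<epsilon> x \<omega>
    proof -
      let ?y = "lattice_point \<epsilon> (floor_vec (x /\<^sub>R \<epsilon>))"
      have sol: "bounded_lattice_solution M \<tau> k b f \<epsilon> (u\<epsilon> \<epsilon>)"
        using asm \<epsilon> by blast
      have "\<bar>u\<epsilon> \<epsilon> ?y \<omega> - u ?y\<bar> \<le> C * \<epsilon>"
      proof (rule C[rule_format, OF \<epsilon> \<omega>])
        show "bounded (range (\<lambda>z. u\<epsilon> \<epsilon> (lattice_point \<epsilon> z) \<omega>))"
          by (rule bounded_subset[of "{u\<epsilon> \<epsilon> x \<omega> | x \<omega>. x \<in> range (lattice_point \<epsilon>) \<and> \<omega> \<in> space M}"])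
            (use sol \<omega> in \<open>auto simp: bounded_lattice_solution_def\<close>)
        show "(1 + \<epsilon>\<^sup>2) * u\<epsilon> \<epsilon> (lattice_point \<epsilon> z) \<omega> =
            walk_mean \<omega> (\<lambda>z. u\<epsilon> \<epsilon> (lattice_point \<epsilon> z) \<omega>) z + \<epsilon>\<^sup>2 * f (lattice_point \<epsilon> z)" for z
          using sol \<omega> unfolding bounded_lattice_solution_def lattice_solution_iff[OF refl] by blast
      qed
      moreover have "\<bar>u ?y - u x\<bar> \<le> L * (real CARD('d) * \<epsilon>)"
        using L[of ?y x] mult_left_mono[OF norm_lattice_point_floor[OF \<epsilon>(1), of x] \<open>0 \<le> L\<close>] by linarith
      ultimately show ?thesis
        unfolding D_def distrib_right mult.assoc by linarith
    qed
    let ?S = "\<lambda>\<epsilon>. SUP (x, \<omega>)\<in>UNIV \<times> space M.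
            \<bar>u\<epsilon> \<epsilon> (lattice_point \<epsilon> (floor_vec (x /\<^sub>R \<epsilon>))) \<omega> - u x\<bar>"
    \<comment> \<open>The bound D \<epsilon> makes the real-valued supremum a genuine one; its
      nonnegativity is read off at the point 0 and \<omega>0.\<close>
    have S: "0 \<le> ?S \<epsilon> \<and> ?S \<epsilon> \<le> D * \<epsilon>" if \<epsilon>: "0 < \<epsilon>" "\<epsilon> \<le> 1" for \<epsilon>
    proof
      let ?g = "\<lambda>(x, \<omega>). \<bar>u\<epsilon> \<epsilon> (lattice_point \<epsilon> (floor_vec (x /\<^sub>R \<epsilon>))) \<omega> - u x\<bar>"
      have "bdd_above (?g ` (UNIV \<times> space M))"
        by (rule bdd_aboveI2[of _ _ "D * \<epsilon>"]) (use bound[OF \<epsilon>] in auto)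
      then have "?g (0, \<omega>0) \<le> ?S \<epsilon>"
        using \<omega>01(1) by (intro cSUP_upper) auto
      then show "0 \<le> ?S \<epsilon>" by (simp only: split_conv)
      show "?S \<epsilon> \<le> D * \<epsilon>"
        by (rule cSUP_least) (use bound[OF \<epsilon>] \<omega>01(1) in auto)
    qed
    have ev: "\<forall>\<^sub>F \<epsilon> in at_right 0. 0 < \<epsilon> \<and> \<epsilon> \<le> (1 :: real)"
      unfolding eventually_at_right_field by (intro exI[of _ 1]) auto
    show "(?S \<longlongrightarrow> 0) (at_right 0)"
    proof (rule tendsto_sandwich[where f = "\<lambda>_. 0" and h = "\<lambda>\<epsilon>. D * \<epsilon>"])
      show "\<forall>\<^sub>F \<epsilon> in at_right 0. 0 \<le> ?S \<epsilon>"
        by (rule eventually_mono[OF ev]) (simp only: S)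
      show "\<forall>\<^sub>F \<epsilon> in at_right 0. ?S \<epsilon> \<le> D * \<epsilon>"
        by (rule eventually_mono[OF ev]) (simp only: S)
      have "((\<lambda>\<epsilon>. D * \<epsilon>) \<longlongrightarrow> D * 0) (at_right 0)"
        by (intro tendsto_intros)
      then show "((\<lambda>\<epsilon>. D * \<epsilon>) \<longlongrightarrow> 0) (at_right 0)"
        by simp
    qed simp
  qed
qed

end
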